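(* For each countable group $G$, the cone $T_{\mathrm{lsc}}(\ell^\infty(G,\mathcal{K}))$ of densely defined lower semi-continuous traces on $\ell^\infty(G,\mathcal{K})$ is equal to the cone of finite positive linear combinations of the traces $\tau_s$, $s \in G$, i.e., traces of the form $\sum_{s \in G} c_s \tau_s$, where $c_s \ge 0$ and $c_s \neq 0$ for only finitely many $s \in G$.
   Context: $\mathcal{K}$ is the $C^*$-algebra of compact operators on a separable infinite dimensional Hilbert space, $\mathcal{F} \subseteq \mathcal{K}$ the set of finite rank operators, $\mathrm{Tr}$ the standard trace, and $\ell^\infty(G,\mathcal{K})$ the $C^*$-algebra of bounded functions $G \to \mathcal{K}$. The Pedersen ideal $\mathrm{Ped}(\mathcal{A})$ of a $C^*$-algebra $\mathcal{A}$ is its smallest dense (algebraic) two-sided ideal; for $\mathcal{A} = \ell^\infty(G,\mathcal{K})$ it equals $\ell^\infty(G,\mathcal{F})$, the bounded (in operator norm) functions $G \to \mathcal{F}$. $T_{\mathrm{lsc}}(\mathcal{A})$ is the cone of positive linear maps $\tau \colon \mathrm{Ped}(\mathcal{A}) \to \mathbb{C}$ satisfying $\tau(x^*x)=\tau(xx^* )$ whenever $x \in \mathcal{A}$ and $x^*x \in \mathrm{Ped}(\mathcal{A})$; it is identified with the cone of densely defined lower semi-continuous traces on $\mathcal{A}$. For $s \in G$, $\tau_s(f) = \mathrm{Tr}(f(s))$ for $f \in \ell^\infty(G,\mathcal{F})$. *)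

theory Defs
  imports "HOL-Analysis.Analysis" "HOL-Algebra.Group"
begin

section \<open>Complex Hilbert spaces\<close>

text \<open>
  The inner product \<open>cinner\<close> is conjugate-linear in the first and linear in the second argument.
  Positive definiteness and the relation to the norm are inherited from \<^class>\<open>real_inner\<close>, since
  \<open>cinner x x\<close> is real by conjugate symmetry.
\<close>

class complex_hilbert_space = real_inner + complete_space +
  fixes scaleC :: "complex \<Rightarrow> 'a \<Rightarrow> 'a"  (infixr \<open>*\<^sub>C\<close> 75)
    and cinner :: "'a \<Rightarrow> 'a \<Rightarrow> complex"
  assumes scaleC_add_right: "c *\<^sub>C (x + y) = c *\<^sub>C x + c *\<^sub>C y"
    and scaleC_add_left: "(c + d) *\<^sub>C x = c *\<^sub>C x + d *\<^sub>C x"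
    and scaleC_scaleC: "c *\<^sub>C d *\<^sub>C x = (c * d) *\<^sub>C x"
    and scaleR_scaleC: "r *\<^sub>R x = complex_of_real r *\<^sub>C x"
    and cinner_commute: "cinner x y = cnj (cinner y x)"
    and cinner_add_right: "cinner x (y + z) = cinner x y + cinner x z"
    and cinner_scaleC_right: "cinner x (c *\<^sub>C y) = c * cinner x y"
    and inner_eq_Re_cinner: "inner x y = Re (cinner x y)"

lemma scaleC_one: "1 *\<^sub>C (x :: 'a :: complex_hilbert_space) = x"
  using scaleR_scaleC[of 1 x] by simp

global_interpretation complex_vector:
  vector_space "scaleC :: complex \<Rightarrow> 'a \<Rightarrow> 'a :: complex_hilbert_space"
  by unfold_locales (simp_all add: scaleC_add_right scaleC_add_left scaleC_scaleC scaleC_one)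

lemma norm_scaleC: "norm (c *\<^sub>C (x :: 'a :: complex_hilbert_space)) = cmod c * norm x"
proof -
  have "cinner (c *\<^sub>C x) (c *\<^sub>C x) = c * (cnj c * cinner x x)"
    by (metis cinner_commute cinner_scaleC_right complex_cnj_mult)
  also have "\<dots> = complex_of_real ((cmod c)\<^sup>2) * cinner x x"
    by (metis complex_norm_square mult.assoc)
  finally have "inner (c *\<^sub>C x) (c *\<^sub>C x) = (cmod c)\<^sup>2 * inner x x"
    by (simp add: inner_eq_Re_cinner)
  then show ?thesis
    by (simp add: norm_eq_sqrt_inner real_sqrt_mult)
qed

definition infinite_dimensional :: "'h :: complex_hilbert_space itself \<Rightarrow> bool" where
  "infinite_dimensional _ \<longleftrightarrow>
     \<not> (\<exists>B :: 'h set. finite B \<and> complex_vector.span B = UNIV)"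

definition is_orthonormal_basis :: "'h :: complex_hilbert_space set \<Rightarrow> bool" where
  "is_orthonormal_basis E \<longleftrightarrow>
     (\<forall>e\<in>E. norm e = 1) \<and>
     (\<forall>e\<in>E. \<forall>f\<in>E. e \<noteq> f \<longrightarrow> cinner e f = 0) \<and>
     closure (complex_vector.span E) = UNIV"


section \<open>C*-algebras and their Pedersen ideals\<close>

text \<open>
  The (not necessarily unital) algebra is the set \<open>elems\<close>; the operations are only meaningful there.
\<close>

record 'a cstar =
  elems :: "'a set"
  plus_in :: "'a \<Rightarrow> 'a \<Rightarrow> 'a"
  scale_in :: "complex \<Rightarrow> 'a \<Rightarrow> 'a"
  mult_in :: "'a \<Rightarrow> 'a \<Rightarrow> 'a"
  star_in :: "'a \<Rightarrow> 'a"
  norm_in :: "'a \<Rightarrow> real"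

definition two_sided_ideal :: "'a cstar \<Rightarrow> 'a set \<Rightarrow> bool" where
  "two_sided_ideal A I \<longleftrightarrow>
     I \<subseteq> elems A \<and> I \<noteq> {} \<and>
     (\<forall>x\<in>I. \<forall>y\<in>I. plus_in A x y \<in> I) \<and>
     (\<forall>c. \<forall>x\<in>I. scale_in A c x \<in> I) \<and>
     (\<forall>a\<in>elems A. \<forall>x\<in>I. mult_in A a x \<in> I \<and> mult_in A x a \<in> I)"

definition dense_in :: "'a cstar \<Rightarrow> 'a set \<Rightarrow> bool" where
  "dense_in A I \<longleftrightarrow>
     (\<forall>a\<in>elems A. \<forall>\<epsilon>>0. \<exists>x\<in>I. norm_in A (plus_in A a (scale_in A (-1) x)) < \<epsilon>)"

text \<open>
  Every C*-algebra has a smallest dense two-sided ideal, which is then the intersection of all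
  dense two-sided ideals.
\<close>

definition Ped :: "'a cstar \<Rightarrow> 'a set" where
  "Ped A = \<Inter> {I. two_sided_ideal A I \<and> dense_in A I}"

definition positive_in :: "'a cstar \<Rightarrow> 'a \<Rightarrow> bool" where
  "positive_in A x \<longleftrightarrow> (\<exists>y\<in>elems A. x = mult_in A (star_in A y) y)"

text \<open>
  Functionals on \<open>Ped A\<close> are represented by functions that are \<open>undefined\<close> outside \<open>Ped A\<close>, so
  that equality of functionals is equality in HOL.
\<close>

definition T_lsc :: "'a cstar \<Rightarrow> ('a \<Rightarrow> complex) set" where
  "T_lsc A = {\<tau> \<in> extensional (Ped A).
     (\<forall>x\<in>Ped A. \<forall>y\<in>Ped A. \<tau> (plus_in A x y) = \<tau> x + \<tau> y) \<and>
     (\<forall>c. \<forall>x\<in>Ped A. \<tau> (scale_in A c x) = c * \<tau> x) \<and>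
     (\<forall>x\<in>Ped A. positive_in A x \<longrightarrow> \<tau> x \<in> \<real>\<^sub>\<ge>\<^sub>0) \<and>
     (\<forall>x\<in>elems A. mult_in A (star_in A x) x \<in> Ped A \<longrightarrow>
        \<tau> (mult_in A (star_in A x) x) = \<tau> (mult_in A x (star_in A x)))}"

definition bounded_functions :: "'g set \<Rightarrow> 'a cstar \<Rightarrow> 'a set \<Rightarrow> ('g \<Rightarrow> 'a) set" where
  "bounded_functions S A B = {f \<in> S \<rightarrow>\<^sub>E B. bdd_above ((\<lambda>s. norm_in A (f s)) ` S)}"

text \<open>The norm is the supremum norm for nonempty \<open>S\<close>.\<close>

definition linf :: "'g set \<Rightarrow> 'a cstar \<Rightarrow> ('g \<Rightarrow> 'a) cstar" where
  "linf S A =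
     \<lparr> elems = bounded_functions S A (elems A),
       plus_in = (\<lambda>f g. \<lambda>s\<in>S. plus_in A (f s) (g s)),
       scale_in = (\<lambda>c f. \<lambda>s\<in>S. scale_in A c (f s)),
       mult_in = (\<lambda>f g. \<lambda>s\<in>S. mult_in A (f s) (g s)),
       star_in = (\<lambda>f. \<lambda>s\<in>S. star_in A (f s)),
       norm_in = (\<lambda>f. SUP s\<in>S. norm_in A (f s)) \<rparr>"


section \<open>Compact and finite rank operators\<close>

text \<open>
  Elements of the type \<open>'h \<Rightarrow>\<^sub>L 'h\<close> are only real-linear; its norm is the operator norm.
\<close>

definition complex_linear :: "('h :: complex_hilbert_space \<Rightarrow>\<^sub>L 'h) \<Rightarrow> bool" where
  "complex_linear a \<longleftrightarrow> (\<forall>c x. blinfun_apply a (c *\<^sub>C x) = c *\<^sub>C blinfun_apply a x)"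

lift_definition scaleC_blinfun ::
  "complex \<Rightarrow> ('h :: complex_hilbert_space \<Rightarrow>\<^sub>L 'h) \<Rightarrow> 'h \<Rightarrow>\<^sub>L 'h"
  is "\<lambda>c a x. c *\<^sub>C a x"
proof -
  fix c and a :: "'h \<Rightarrow> 'h"
  assume "bounded_linear a"
  moreover have "bounded_linear (\<lambda>x :: 'h. c *\<^sub>C x)"
    by (rule bounded_linear_intro[where K = "cmod c"])
       (simp_all add: scaleC_add_right scaleR_scaleC scaleC_scaleC norm_scaleC mult.commute)
  ultimately show "bounded_linear (\<lambda>x. c *\<^sub>C a x)"
    by (rule bounded_linear_compose[rotated])
qed

definition adj :: "('h :: complex_hilbert_space \<Rightarrow>\<^sub>L 'h) \<Rightarrow> 'h \<Rightarrow>\<^sub>L 'h" where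
  "adj a = (THE b. \<forall>x y. cinner (blinfun_apply b x) y = cinner x (blinfun_apply a y))"

definition compact_operators :: "('h :: complex_hilbert_space \<Rightarrow>\<^sub>L 'h) cstar" where
  "compact_operators =
     \<lparr> elems = {a. complex_linear a \<and> compact (closure (blinfun_apply a ` cball 0 1))},
       plus_in = (+),
       scale_in = scaleC_blinfun,
       mult_in = (o\<^sub>L),
       star_in = adj,
       norm_in = norm \<rparr>"

definition finite_rank_operators :: "('h :: complex_hilbert_space \<Rightarrow>\<^sub>L 'h) set" where
  "finite_rank_operators =
     {a. complex_linear a \<and>
         (\<exists>B. finite B \<and> range (blinfun_apply a) \<subseteq> complex_vector.span B)}"

text \<open>
  For finite rank operators the sum converges absolutely and does not depend on the choice of the
  orthonormal basis.
\<close>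

definition Tr :: "('h :: complex_hilbert_space \<Rightarrow>\<^sub>L 'h) \<Rightarrow> complex" where
  "Tr a = (\<Sum>\<^sub>\<infinity>e\<in>(SOME E. is_orthonormal_basis E). cinner e (blinfun_apply a e))"

definition linf_finite_rank :: "'g set \<Rightarrow> ('g \<Rightarrow> 'h :: complex_hilbert_space \<Rightarrow>\<^sub>L 'h) set" where
  "linf_finite_rank S = bounded_functions S compact_operators finite_rank_operators"

definition tau :: "'g set \<Rightarrow> 'g \<Rightarrow> ('g \<Rightarrow> 'h :: complex_hilbert_space \<Rightarrow>\<^sub>L 'h) \<Rightarrow> complex" where
  "tau S s = (\<lambda>f\<in>linf_finite_rank S. Tr (f s))"

text \<open>
  The sum ranges over the finite support of \<open>c\<close>. The domain \<open>linf_finite_rank S\<close> of these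
  functionals is \<open>Ped (linf S compact_operators)\<close>.
\<close>

definition finite_positive_combinations ::
  "'g set \<Rightarrow> (('g \<Rightarrow> 'h :: complex_hilbert_space \<Rightarrow>\<^sub>L 'h) \<Rightarrow> complex) set" where
  "finite_positive_combinations S =
     {(\<lambda>f\<in>linf_finite_rank S. \<Sum>s | s \<in> S \<and> c s \<noteq> 0. complex_of_real (c s) * tau S s f) | c.
        (\<forall>s\<in>S. 0 \<le> c s) \<and> finite {s\<in>S. c s \<noteq> 0}}"

end

theory Submission
  imports Defs
begin

text \<open>
  The Pedersen ideal is \<open>\<ell>\<^sup>\<infinity>(G, \<F>)\<close>: if \<open>p s\<close> is the range projection of \<open>f s\<close> and \<open>x\<close> lies in a
  dense ideal close to \<open>p\<close>, then \<open>p x p\<close> is invertible in the corner of \<open>p\<close>, so \<open>p\<close> and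
  \<open>f = p f\<close> lie in the ideal.

  A trace \<open>\<tau>\<close> takes the same value \<open>\<phi> n\<close> on all projections whose rank at \<open>s\<close> is \<open>n s\<close>, and \<open>\<phi>\<close> is
  additive and nonnegative on all functions \<open>n : G \<rightarrow> \<nat>\<close>. If \<open>c s = \<phi> \<delta>\<^sub>s\<close> were nonzero for infinitely many
  \<open>s\<close>, then \<open>n s \<ge> 1 / c s\<close> would give \<open>\<phi> n = \<infinity>\<close>. If \<open>n\<close> vanishes on the finite support of \<open>c\<close>, let
  \<open>m s = k s * n s\<close> for an injection \<open>k : G \<rightarrow> \<nat>\<close>; then \<open>N * n \<le> m\<close> off a finite set, so
  \<open>N * \<phi> n \<le> \<phi> m\<close> for every \<open>N\<close> and \<open>\<phi> n = 0\<close>. By the Cauchy-Schwarz inequality \<open>\<tau>\<close> then kills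
  everything supported off the support of \<open>c\<close>, and at a single point uniqueness of the trace on the
  finite rank operators applies.
\<close>

section \<open>Inner products\<close>

lemma cinner_add_left: "cinner (x + y) z = cinner x z + cinner y z"
  by (metis cinner_commute cinner_add_right complex_cnj_add)

lemma cinner_scaleC_left: "cinner (c *\<^sub>C x) y = cnj c * cinner x y"
  by (metis cinner_commute cinner_scaleC_right complex_cnj_mult)

lemma cinner_zero_right [simp]: "cinner x 0 = 0"
  using cinner_add_right[of x 0 0] by simp

lemma cinner_zero_left [simp]: "cinner 0 x = 0"
  using cinner_add_left[of 0 0 x] by simp

lemma cinner_minus_right: "cinner x (- y) = - cinner x y"
  using cinner_add_right[of x y "- y"] by (simp add: eq_neg_iff_add_eq_0 add.commute)

lemma cinner_diff_right: "cinner x (y - z) = cinner x y - cinner x z"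
  using cinner_add_right[of x y "- z"] by (simp add: cinner_minus_right)

lemma cinner_diff_left: "cinner (x - y) z = cinner x z - cinner y z"
  by (metis cinner_commute cinner_diff_right complex_cnj_diff)

lemma cinner_sum_right: "cinner x (\<Sum>i\<in>I. f i) = (\<Sum>i\<in>I. cinner x (f i))"
  by (induction I rule: infinite_finite_induct) (simp_all add: cinner_add_right)

lemma cinner_sum_left: "cinner (\<Sum>i\<in>I. f i) x = (\<Sum>i\<in>I. cinner (f i) x)"
  by (induction I rule: infinite_finite_induct) (simp_all add: cinner_add_left)

lemma cinner_self: "cinner x x = complex_of_real ((norm x)\<^sup>2)"
proof (rule complex_eqI)
  show "Re (cinner x x) = Re (complex_of_real ((norm x)\<^sup>2))"
    by (simp add: power2_norm_eq_inner inner_eq_Re_cinner)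
  show "Im (cinner x x) = Im (complex_of_real ((norm x)\<^sup>2))"
    using cinner_commute[of x x] by (simp add: complex_eq_iff)
qed

lemma cinner_self_eq_0_iff [simp]: "cinner x x = 0 \<longleftrightarrow> x = 0"
  by (simp add: cinner_self)

lemma cinner_eqI:
  assumes "\<And>y. cinner x y = cinner x' y"
  shows "x = x'"
  using assms[of "x - x'"] cinner_self_eq_0_iff[of "x - x'"] by (simp add: cinner_diff_left)

text \<open>Multiplying \<open>y\<close> by a phase turns the complex inner product into its
  modulus, which is then a real inner product, and the real Cauchy-Schwarz inequality
  applies.\<close>

lemma cmod_cinner_le: "cmod (cinner x y) \<le> norm x * norm y"
proof (cases "cinner x y = 0")
  case False
  define c where "c = cnj (cinner x y) / cmod (cinner x y)"
  have "c * cinner x y = cmod (cinner x y)"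
    using False by (simp add: c_def complex_norm_square[symmetric] power2_eq_square mult.commute)
  then have "cmod (cinner x y) = inner x (c *\<^sub>C y)"
    by (simp add: inner_eq_Re_cinner cinner_scaleC_right)
  also have "\<dots> \<le> norm x * norm (c *\<^sub>C y)"
    by (rule norm_cauchy_schwarz)
  also have "\<dots> = norm x * norm y"
    using False by (simp add: norm_scaleC c_def norm_divide)
  finally show ?thesis .
qed simp

lemma norm_add_sq:
  assumes "cinner x y = 0"
  shows "(norm (x + y))\<^sup>2 = (norm x)\<^sup>2 + (norm y)\<^sup>2"
proof -
  have "inner x y = 0"
    using assms by (simp add: inner_eq_Re_cinner)
  then show ?thesis
    by (simp add: power2_norm_eq_inner inner_add_left inner_add_right inner_commute)
qed

section \<open>Bounded linear maps, nearest points and the Riesz representation\<close>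

lemma bounded_linear_scaleC_right: "bounded_linear (\<lambda>x. c *\<^sub>C (x :: 'h :: complex_hilbert_space))"
  by (rule bounded_linear_intro[where K = "cmod c"])
     (simp_all add: scaleC_add_right scaleR_scaleC scaleC_scaleC norm_scaleC mult.commute)

lemma bounded_linear_cinner_right: "bounded_linear (cinner x)"
  by (rule bounded_linear_intro[where K = "norm x"])
     (simp_all add: cinner_add_right scaleR_scaleC cinner_scaleC_right
        scaleR_conv_of_real cmod_cinner_le[THEN order_trans] mult.commute)

lemma bounded_linear_scaleC_left: "bounded_linear (\<lambda>c. c *\<^sub>C (x :: 'h :: complex_hilbert_space))"
  by (rule bounded_linear_intro[where K = "norm x"])
     (simp_all add: scaleC_add_left scaleR_scaleC scaleC_scaleC norm_scaleC scaleR_conv_of_real)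

text \<open>A sequence in \<open>M\<close> whose distances to \<open>x\<close> tend to the infimum
  is Cauchy by the parallelogram law. Its limit attains the infimum, and then moving it along
  \<open>z\<close> cannot bring it closer to \<open>x\<close>, which forces orthogonality.\<close>

lemma closed_subspace_nearest_point:
  fixes M :: "'a :: {real_inner, complete_space} set"
  assumes M: "subspace M" "closed M"
  obtains y where "y \<in> M" "\<And>z. z \<in> M \<Longrightarrow> inner (x - y) z = 0"
proof -
  define d where "d = infdist x M"
  have "0 \<in> M"
    using M(1) by (rule subspace_0)
  then have ne: "M \<noteq> {}" by auto
  have d0: "d \<ge> 0"
    by (simp add: d_def infdist_nonneg)
  have le: "d \<le> norm (x - z)" if "z \<in> M" for z
    using infdist_le[OF that, of x] by (simp add: d_def dist_norm)
  have "\<exists>z\<in>M. norm (x - z) < d + e" if "e > 0" for e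
  proof (rule ccontr)
    assume "\<not> ?thesis"
    then have "d + e \<le> infdist x M"
      unfolding infdist_notempty[OF ne] using ne
      by (intro cINF_greatest) (auto simp: dist_norm not_less)
    then show False
      using that by (simp add: d_def)
  qed
  then have "\<exists>m. \<forall>n. m n \<in> M \<and> norm (x - m n) < d + 1 / real (Suc n)"
    by (intro choice allI) (simp add: Bex_def)
  then obtain m where m: "\<And>n. m n \<in> M" "\<And>n. norm (x - m n) < d + 1 / real (Suc n)"
    by blast
  \<comment> \<open>Parallelogram law for \<open>x - u\<close> and \<open>x - v\<close>: the
    midpoint of \<open>u\<close> and \<open>v\<close> lies in \<open>M\<close>, so its distance to
    \<open>x\<close> is at least \<open>d\<close>.\<close>
  have par: "(norm (u - v))\<^sup>2 \<le> 4 * ((d + r)\<^sup>2 - d\<^sup>2)"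
    if uv: "u \<in> M" "v \<in> M" "norm (x - u) \<le> d + r" "norm (x - v) \<le> d + r" for u v r
  proof -
    have "(1/2) *\<^sub>R (u + v) \<in> M"
      using uv M(1) by (intro subspace_mul subspace_add)
    then have "d\<^sup>2 \<le> (norm (x - (1/2) *\<^sub>R (u + v)))\<^sup>2"
      using le d0 by (intro power_mono) auto
    moreover have "(norm (u - v))\<^sup>2 + 4 * (norm (x - (1/2) *\<^sub>R (u + v)))\<^sup>2
      = 2 * (norm (x - u))\<^sup>2 + 2 * (norm (x - v))\<^sup>2"
      by (simp add: power2_norm_eq_inner inner_diff_left inner_diff_right inner_add_left
          inner_add_right inner_commute algebra_simps)
    moreover have "(norm (x - u))\<^sup>2 \<le> (d + r)\<^sup>2" "(norm (x - v))\<^sup>2 \<le> (d + r)\<^sup>2"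
      using uv by (auto intro!: power_mono)
    ultimately show ?thesis by (simp add: algebra_simps)
  qed
  have "Cauchy m"
    unfolding Cauchy_iff
  proof (intro allI impI)
    fix e :: real assume e: "e > 0"
    have "(\<lambda>n. 4 * ((d + 1 / real (Suc n))\<^sup>2 - d\<^sup>2)) \<longlonglongrightarrow> 4 * ((d + 0)\<^sup>2 - d\<^sup>2)"
      by (intro tendsto_intros LIMSEQ_inverse_real_of_nat[unfolded inverse_eq_divide])
    then have "\<forall>\<^sub>F n in sequentially. 4 * ((d + 1 / real (Suc n))\<^sup>2 - d\<^sup>2) < e\<^sup>2"
      using e by (intro order_tendstoD(2)) auto
    then obtain N where N: "4 * ((d + 1 / real (Suc N))\<^sup>2 - d\<^sup>2) < e\<^sup>2"
      by (auto simp: eventually_sequentially)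
    show "\<exists>N. \<forall>i\<ge>N. \<forall>j\<ge>N. norm (m i - m j) < e"
    proof (intro exI[of _ N] allI impI)
      fix i j assume ij: "N \<le> i" "N \<le> j"
      have "norm (x - m k) \<le> d + 1 / real (Suc N)" if "N \<le> k" for k
        using m(2)[of k] that frac_le[of 1 1 "real (Suc N)" "real (Suc k)"] by simp
      then have "(norm (m i - m j))\<^sup>2 < e\<^sup>2"
        using par[OF m(1) m(1), of i "1 / real (Suc N)" j] ij N by force
      then show "norm (m i - m j) < e"
        using e by (simp add: power2_less_imp_less)
    qed
  qed
  then obtain y where y: "m \<longlonglongrightarrow> y"
    by (meson Cauchy_convergent_iff convergent_def)
  have yM: "y \<in> M"
    using M(2) m(1) y by (rule closed_sequentially)
  have "norm (x - y) \<le> d + 0"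
  proof (rule LIMSEQ_le)
    show "(\<lambda>n. norm (x - m n)) \<longlonglongrightarrow> norm (x - y)"
      by (intro tendsto_intros y)
    show "(\<lambda>n. d + 1 / real (Suc n)) \<longlonglongrightarrow> d + 0"
      by (intro tendsto_intros LIMSEQ_inverse_real_of_nat[unfolded inverse_eq_divide])
    show "\<exists>N. \<forall>n\<ge>N. norm (x - m n) \<le> d + 1 / real (Suc n)"
      using m(2) less_imp_le by blast
  qed
  then have yd: "norm (x - y) \<le> d" by simp
  have "inner (x - y) z = 0" if z: "z \<in> M" for z
  proof (cases "z = 0")
    case False
    \<comment> \<open>This \<open>t\<close> minimises the norm of
      \<open>(x - y) - t *\<^sub>R z\<close>; the minimum is below \<open>norm (x - y)\<close>
      unless the inner product vanishes.\<close>
    define t where "t = inner (x - y) z / (norm z)\<^sup>2"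
    have expand: "(norm (p - t *\<^sub>R z))\<^sup>2 = (norm p)\<^sup>2 - 2 * t * inner p z + t\<^sup>2 * (norm z)\<^sup>2" for p
      unfolding power2_norm_eq_inner
      by (simp add: inner_diff_left inner_diff_right inner_commute[of z p] algebra_simps power2_eq_square)
    have "y + t *\<^sub>R z \<in> M"
      using M(1) yM z by (intro subspace_add subspace_mul)
    then have "norm (x - y) \<le> norm (x - (y + t *\<^sub>R z))"
      using le yd by (meson order_trans)
    then have "norm (x - y) \<le> norm ((x - y) - t *\<^sub>R z)"
      by (simp only: diff_diff_add)
    then have "(norm (x - y))\<^sup>2 \<le> (norm ((x - y) - t *\<^sub>R z))\<^sup>2"
      by (rule power_mono) simp
    also have "\<dots> = (norm (x - y))\<^sup>2 - 2 * t * inner (x - y) z + t\<^sup>2 * (norm z)\<^sup>2"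
      by (rule expand)
    also have "\<dots> = (norm (x - y))\<^sup>2 - (inner (x - y) z)\<^sup>2 / (norm z)\<^sup>2"
      using False by (simp add: t_def power2_eq_square field_simps)
    finally have "(inner (x - y) z)\<^sup>2 / (norm z)\<^sup>2 \<le> 0" by simp
    then show ?thesis
      using False by (simp add: divide_le_0_iff)
  qed simp
  with yM show thesis by (rule that)
qed

text \<open>The real nearest point already works: \<open>M\<close> contains
  \<open>\<i> *\<^sub>C z\<close> along with \<open>z\<close>, and real orthogonality to both kills
  the real and the imaginary part of the complex inner product.\<close>

lemma orthogonal_complement_point:
  fixes M :: "'h :: complex_hilbert_space set"
  assumes M: "complex_vector.subspace M" "closed M" "x \<notin> M"
  obtains y w where "y \<in> M" "x = y + w" "w \<noteq> 0" "\<And>z. z \<in> M \<Longrightarrow> cinner w z = 0"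
proof -
  have "subspace M"
    using M(1) unfolding subspace_def complex_vector.subspace_def scaleR_scaleC by blast
  then obtain y where y: "y \<in> M" "\<And>z. z \<in> M \<Longrightarrow> inner (x - y) z = 0"
    using closed_subspace_nearest_point M(2) by blast
  show thesis
  proof (rule that[of y "x - y"])
    show "cinner (x - y) z = 0" if z: "z \<in> M" for z
    proof -
      have "\<i> *\<^sub>C z \<in> M"
        using M(1) z by (rule complex_vector.subspace_scale)
      then have "Re (\<i> * cinner (x - y) z) = 0"
        using y(2)[of "\<i> *\<^sub>C z"] by (simp only: inner_eq_Re_cinner cinner_scaleC_right)
      moreover have "Re (cinner (x - y) z) = 0"
        using y(2)[OF z] by (simp add: inner_eq_Re_cinner)
      ultimately show ?thesis
        by (simp add: complex_eq_iff)
    qed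
  qed (use y M(3) in auto)
qed

text \<open>The kernel of a nonzero \<open>f\<close> is closed, so some nonzero \<open>w\<close> is
  orthogonal to it. Every vector is a multiple of \<open>w\<close> plus a kernel element, hence a
  suitable multiple of \<open>w\<close> represents \<open>f\<close>.\<close>

theorem riesz_representation:
  fixes f :: "'h :: complex_hilbert_space \<Rightarrow> complex"
  assumes f: "bounded_linear f" "\<And>c x. f (c *\<^sub>C x) = c * f x"
  obtains z where "\<And>x. f x = cinner z x"
proof (cases "\<forall>x. f x = 0")
  case True
  then show thesis by (intro that[of 0]) simp
next
  case False
  then obtain x0 where x0: "f x0 \<noteq> 0" by blast
  interpret bounded_linear f by fact
  define M where "M = {x. f x = 0}"
  have "complex_vector.subspace M"
    unfolding complex_vector.subspace_def M_def by (simp add: zero add f(2))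
  moreover have "closed M"
    unfolding M_def by (intro closed_Collect_eq continuous_on continuous_intros)
  ultimately obtain y w where w: "y \<in> M" "x0 = y + w" "w \<noteq> 0" "\<And>z. z \<in> M \<Longrightarrow> cinner w z = 0"
    using x0 by (elim orthogonal_complement_point[of M x0]) (auto simp: M_def)
  have fw: "f w \<noteq> 0"
    using x0 w(1,2) by (auto simp: M_def add)
  show thesis
  proof (rule that[of "(cnj (f w) / (norm w)\<^sup>2) *\<^sub>C w"])
    fix x
    have "x - (f x / f w) *\<^sub>C w \<in> M"
      using fw by (simp add: M_def diff f(2))
    then have "cinner w x = (f x / f w) * (norm w)\<^sup>2"
      using w(4)[of "x - (f x / f w) *\<^sub>C w"]
      by (simp add: cinner_diff_right cinner_scaleC_right cinner_self)
    then show "f x = cinner ((cnj (f w) / (norm w)\<^sup>2) *\<^sub>C w) x"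
      using fw w(3) by (simp add: cinner_scaleC_left)
  qed
qed


section \<open>Orthonormal families\<close>

text \<open>Indexed families rather than sets, so that two of them can be paired by index as in
  \<open>ketbra_sum\<close>. A set is covered by its identity family.\<close>

definition orthonormal_on :: "'i set \<Rightarrow> ('i \<Rightarrow> 'h :: complex_hilbert_space) \<Rightarrow> bool" where
  "orthonormal_on I u \<longleftrightarrow> (\<forall>i\<in>I. \<forall>j\<in>I. cinner (u i) (u j) = of_bool (i = j))"

lemma orthonormal_onD:
  "orthonormal_on I u \<Longrightarrow> i \<in> I \<Longrightarrow> j \<in> I \<Longrightarrow> cinner (u i) (u j) = of_bool (i = j)"
  by (simp add: orthonormal_on_def)

lemma orthonormal_on_subset: "orthonormal_on I u \<Longrightarrow> J \<subseteq> I \<Longrightarrow> orthonormal_on J u"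
  unfolding orthonormal_on_def by blast

lemma orthonormal_on_norm:
  assumes "orthonormal_on I u" "i \<in> I"
  shows "norm (u i) = 1"
proof -
  have "complex_of_real ((norm (u i))\<^sup>2) = 1"
    using orthonormal_onD[OF assms(1,2,2)] by (simp only: cinner_self) simp
  then have "(norm (u i))\<^sup>2 = 1"
    using of_real_eq_1_iff by blast
  then show ?thesis
    unfolding power2_eq_1_iff using norm_ge_zero[of "u i"] by linarith
qed

lemma is_orthonormal_basis_iff:
  "is_orthonormal_basis E \<longleftrightarrow>
    orthonormal_on E (\<lambda>e. e) \<and> closure (complex_vector.span E) = UNIV"
proof -
  have "orthonormal_on E (\<lambda>e. e) \<longleftrightarrow>
     (\<forall>e\<in>E. norm e = 1) \<and> (\<forall>e\<in>E. \<forall>f\<in>E. e \<noteq> f \<longrightarrow> cinner e f = 0)"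
  proof
    assume "orthonormal_on E (\<lambda>e. e)"
    then show "(\<forall>e\<in>E. norm e = 1) \<and> (\<forall>e\<in>E. \<forall>f\<in>E. e \<noteq> f \<longrightarrow> cinner e f = 0)"
      using orthonormal_on_norm[of E "\<lambda>e. e"] orthonormal_onD[of E "\<lambda>e. e"] by simp
  next
    assume "(\<forall>e\<in>E. norm e = 1) \<and> (\<forall>e\<in>E. \<forall>f\<in>E. e \<noteq> f \<longrightarrow> cinner e f = 0)"
    then show "orthonormal_on E (\<lambda>e. e)"
      unfolding orthonormal_on_def by (simp add: of_bool_def cinner_self)
  qed
  then show ?thesis
    by (auto simp: is_orthonormal_basis_def)
qed

lemma sum_orthonormal:
  assumes "orthonormal_on I u" "finite I" "j \<in> I"
  shows "cinner (u j) (\<Sum>i\<in>I. c i *\<^sub>C u i) = c j"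
proof -
  have "cinner (u j) (\<Sum>i\<in>I. c i *\<^sub>C u i) = (\<Sum>i\<in>I. if i = j then c i else 0)"
    unfolding cinner_sum_right
    by (intro sum.cong refl) (simp add: cinner_scaleC_right orthonormal_onD[OF assms(1,3)])
  then show ?thesis
    using assms by simp
qed

lemma norm_sum_orthonormal:
  assumes "orthonormal_on I u" "finite I"
  shows "(norm (\<Sum>i\<in>I. c i *\<^sub>C u i))\<^sup>2 = (\<Sum>i\<in>I. (cmod (c i))\<^sup>2)"
proof -
  have "complex_of_real ((norm (\<Sum>i\<in>I. c i *\<^sub>C u i))\<^sup>2) = (\<Sum>i\<in>I. cnj (c i) * c i)"
    unfolding cinner_self[symmetric]
    by (subst cinner_sum_left, intro sum.cong refl)
       (simp only: cinner_scaleC_left sum_orthonormal[OF assms])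
  also have "\<dots> = complex_of_real (\<Sum>i\<in>I. (cmod (c i))\<^sup>2)"
    unfolding of_real_sum by (intro sum.cong refl) (metis complex_norm_square mult.commute)
  finally show ?thesis
    using of_real_eq_iff by blast
qed

text \<open>For \<open>u\<close> orthonormal on a finite \<open>I\<close> this is the orthogonal
  projection of \<open>x\<close> onto the span of the family.\<close>

definition osum :: "'i set \<Rightarrow> ('i \<Rightarrow> 'h :: complex_hilbert_space) \<Rightarrow> 'h \<Rightarrow> 'h" where
  "osum I u x = (\<Sum>i\<in>I. cinner (u i) x *\<^sub>C u i)"

lemma cinner_osum_diff:
  assumes "orthonormal_on I u" "finite I" "z \<in> complex_vector.span (u ` I)"
  shows "cinner z (x - osum I u x) = 0"
  using assms(3)
proof (induction rule: complex_vector.span_induct_alt)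
  case (step c y z)
  then obtain i where "i \<in> I" "y = u i" by blast
  then have "cinner y (x - osum I u x) = 0"
    unfolding osum_def cinner_diff_right by (simp only: sum_orthonormal[OF assms(1,2)]) simp
  with step show ?case
    by (simp add: cinner_add_left cinner_scaleC_left)
qed simp

lemma osum_in_span: "osum I u x \<in> complex_vector.span (u ` I)"
  unfolding osum_def
  by (intro complex_vector.span_sum complex_vector.span_scale complex_vector.span_base) auto

lemma osum_eq:
  assumes "orthonormal_on I u" "finite I" "x \<in> complex_vector.span (u ` I)"
  shows "osum I u x = x"
proof -
  have "x - osum I u x \<in> complex_vector.span (u ` I)"
    using assms(3) osum_in_span by (rule complex_vector.span_diff)
  then have "cinner (x - osum I u x) (x - osum I u x) = 0"
    by (rule cinner_osum_diff[OF assms(1,2)])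
  then show ?thesis by simp
qed

lemma norm_diff_osum_le:
  assumes "orthonormal_on I u" "finite I" "y \<in> complex_vector.span (u ` I)"
  shows "norm (x - osum I u x) \<le> norm (x - y)"
proof -
  have "osum I u x - y \<in> complex_vector.span (u ` I)"
    using osum_in_span assms(3) by (rule complex_vector.span_diff)
  then have "cinner (x - osum I u x) (osum I u x - y) = 0"
    using cinner_osum_diff[OF assms(1,2)] by (metis cinner_commute complex_cnj_zero)
  then have "(norm (x - y))\<^sup>2 = (norm (x - osum I u x))\<^sup>2 + (norm (osum I u x - y))\<^sup>2"
    using norm_add_sq by fastforce
  then show ?thesis
    by (simp add: power2_le_imp_le)
qed

lemma bessel:
  assumes "orthonormal_on I u" "finite I"
  shows "(\<Sum>i\<in>I. (cmod (cinner (u i) x))\<^sup>2) \<le> (norm x)\<^sup>2"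
proof -
  have "cinner (osum I u x) (x - osum I u x) = 0"
    using cinner_osum_diff[OF assms osum_in_span] .
  then have "(norm x)\<^sup>2 = (norm (osum I u x))\<^sup>2 + (norm (x - osum I u x))\<^sup>2"
    using norm_add_sq by fastforce
  then show ?thesis
    using norm_sum_orthonormal[OF assms, of "\<lambda>i. cinner (u i) x"] by (simp add: osum_def)
qed

text \<open>As \<open>u\<close> is orthonormal, the left side is the l2 norm of the coefficients,
  which Bessel's inequality for \<open>v\<close> bounds.\<close>

lemma norm_ketbra_sum_le:
  assumes "orthonormal_on I u" "orthonormal_on I v" "finite I"
  shows "norm (\<Sum>i\<in>I. cinner (v i) x *\<^sub>C u i) \<le> norm x"
  using norm_sum_orthonormal[OF assms(1,3), of "\<lambda>i. cinner (v i) x"] bessel[OF assms(2,3), of x]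
  by (simp add: power2_le_imp_le)

text \<open>Induction on \<open>B\<close>: the part of a new vector orthogonal to the family so far
  is normalised and appended; when it is zero the family stays as it is.\<close>

lemma gram_schmidt:
  fixes B :: "'h :: complex_hilbert_space set"
  assumes "finite B"
  obtains n u where "orthonormal_on {..<n::nat} u" "B \<subseteq> complex_vector.span (u ` {..<n})"
proof -
  have "\<exists>n u. orthonormal_on {..<n::nat} u \<and> B \<subseteq> complex_vector.span (u ` {..<n})"
    using assms
  proof (induction B)
    case empty
    have "orthonormal_on {..<0::nat} (\<lambda>_. 0 :: 'h)" by (simp add: orthonormal_on_def)
    then show ?case by (metis empty_subsetI)
  next
    case (insert b B)
    then obtain n u where u: "orthonormal_on {..<n::nat} u" "B \<subseteq> complex_vector.span (u ` {..<n})"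
      by blast
    define w where "w = b - osum {..<n} u b"
    show ?case
    proof (cases "w = 0")
      case True
      then have "b \<in> complex_vector.span (u ` {..<n})"
        using osum_in_span[of "{..<n}" u b] by (simp add: w_def)
      with u show ?thesis by blast
    next
      case False
      define v where "v = u(n := (1 / norm w) *\<^sub>C w)"
      have uw: "cinner (u i) w = 0" if "i < n" for i
        using that unfolding w_def
        by (intro cinner_osum_diff[OF u(1)] complex_vector.span_base) auto
      then have wu: "cinner w (u i) = 0" if "i < n" for i
        using that by (metis cinner_commute complex_cnj_zero)
      have ww: "cinner w w = norm w * norm w"
        by (simp add: cinner_self power2_eq_square)
      have "orthonormal_on {..<Suc n} v"
        unfolding orthonormal_on_def
      proof (intro ballI)
        fix i j assume ij: "i \<in> {..<Suc n}" "j \<in> {..<Suc n}"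
        then consider "i < n" "j < n" | "i < n" "j = n" | "i = n" "j < n" | "i = n" "j = n"
          by force
        then show "cinner (v i) (v j) = of_bool (i = j)"
          using orthonormal_onD[OF u(1)] uw wu False
          by cases (auto simp: v_def cinner_scaleC_left cinner_scaleC_right ww)
      qed
      moreover have img: "v ` {..<Suc n} = insert ((1 / norm w) *\<^sub>C w) (u ` {..<n})"
        by (auto simp: v_def lessThan_Suc image_iff)
      have sub: "complex_vector.span (u ` {..<n}) \<subseteq> complex_vector.span (v ` {..<Suc n})"
        unfolding img by (intro complex_vector.span_mono) auto
      \<comment> \<open>The new unit vector times \<open>norm w\<close> gives back \<open>w\<close>,
        and \<open>b\<close> is \<open>w\<close> plus the projection of \<open>b\<close>, so
        \<open>b\<close> lies in the enlarged span.\<close>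
      have "complex_of_real (norm w) *\<^sub>C ((1 / norm w) *\<^sub>C w) \<in> complex_vector.span (v ` {..<Suc n})"
        unfolding img by (intro complex_vector.span_scale complex_vector.span_base) auto
      then have "w \<in> complex_vector.span (v ` {..<Suc n})"
        using False by (simp add: scaleC_scaleC scaleC_one)
      then have "w + osum {..<n} u b \<in> complex_vector.span (v ` {..<Suc n})"
        using osum_in_span sub by (blast intro: complex_vector.span_add)
      then have "insert b B \<subseteq> complex_vector.span (v ` {..<Suc n})"
        using u(2) sub by (auto simp: w_def)
      ultimately show ?thesis by blast
    qed
  qed
  then show thesis using that by blast
qed

section \<open>Orthonormal bases and Parseval's identity\<close>

lemma complex_subspace_closure:
  fixes M :: "'h :: complex_hilbert_space set"
  assumes "complex_vector.subspace M"
  shows "complex_vector.subspace (closure M)"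
  unfolding complex_vector.subspace_def
proof (intro conjI ballI allI)
  show "0 \<in> closure M"
    using complex_vector.subspace_0[OF assms] closure_subset by blast
next
  fix x y assume "x \<in> closure M" "y \<in> closure M"
  then obtain f g where "\<And>n. f n \<in> M" "f \<longlonglongrightarrow> x" "\<And>n. g n \<in> M" "g \<longlonglongrightarrow> y"
    by (metis closure_sequential)
  then show "x + y \<in> closure M"
    unfolding closure_sequential using complex_vector.subspace_add[OF assms]
    by (intro exI[of _ "\<lambda>n. f n + g n"]) (auto intro: tendsto_add)
next
  fix c x assume "x \<in> closure M"
  then obtain f where "\<And>n. f n \<in> M" "f \<longlonglongrightarrow> x"
    by (metis closure_sequential)
  then show "c *\<^sub>C x \<in> closure M"
    unfolding closure_sequential using complex_vector.subspace_scale[OF assms]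
    by (intro exI[of _ "\<lambda>n. c *\<^sub>C f n"])
       (auto intro: bounded_linear.tendsto[OF bounded_linear_scaleC_right])
qed

text \<open>Zorn's lemma gives a maximal orthonormal set. If its span were not dense, a unit vector
  orthogonal to the closure of the span could be added.\<close>

lemma orthonormal_basis_exists: "\<exists>E :: 'h :: complex_hilbert_space set. is_orthonormal_basis E"
proof -
  let ?A = "{E :: 'h set. orthonormal_on E (\<lambda>e. e)}"
  have "\<exists>E\<in>?A. \<forall>X\<in>?A. E \<subseteq> X \<longrightarrow> X = E"
  proof (rule subset_Zorn')
    fix C assume C: "subset.chain ?A C"
    show "\<Union>C \<in> ?A"
      unfolding mem_Collect_eq orthonormal_on_def
    proof (intro ballI)
      fix x y assume "x \<in> \<Union>C" "y \<in> \<Union>C"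
      then obtain X Y where XY: "X \<in> C" "Y \<in> C" "x \<in> X" "y \<in> Y" by blast
      then have "X \<subseteq> Y \<or> Y \<subseteq> X"
        using C by (meson subset_chain_def)
      then obtain Z where "Z \<in> C" "x \<in> Z" "y \<in> Z"
        using XY by blast
      moreover then have "orthonormal_on Z (\<lambda>e. e)"
        using C by (auto simp: subset_chain_def)
      ultimately show "cinner x y = of_bool (x = y)"
        using orthonormal_onD by fastforce
    qed
  qed
  then obtain E :: "'h set" where E: "orthonormal_on E (\<lambda>e. e)"
    "\<And>X. orthonormal_on X (\<lambda>e. e) \<Longrightarrow> E \<subseteq> X \<Longrightarrow> X = E"
    by blast
  have "closure (complex_vector.span E) = UNIV"
  proof (rule ccontr)
    assume "closure (complex_vector.span E) \<noteq> UNIV"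
    then obtain x where "x \<notin> closure (complex_vector.span E)" by blast
    then obtain w where w: "w \<noteq> 0" "\<And>z. z \<in> closure (complex_vector.span E) \<Longrightarrow> cinner w z = 0"
      using orthogonal_complement_point complex_subspace_closure complex_vector.subspace_span
        closed_closure by metis
    define v where "v = (1 / norm w) *\<^sub>C w"
    have vE: "cinner v z = 0" if "z \<in> E" for z
    proof -
      have "z \<in> closure (complex_vector.span E)"
        using that closure_subset complex_vector.span_base by blast
      then show ?thesis
        using w(2) by (simp add: v_def cinner_scaleC_left)
    qed
    have "norm v = 1"
      using w(1) by (simp add: v_def norm_scaleC norm_divide)
    then have vv: "cinner v v = 1"
      by (simp add: cinner_self)
    have "v \<notin> E"
      using vE vv by force
    moreover have "orthonormal_on (insert v E) (\<lambda>e. e)"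
      unfolding orthonormal_on_def
    proof (intro ballI)
      fix i j assume "i \<in> insert v E" "j \<in> insert v E"
      moreover have "cinner z v = 0" if "z \<in> E" for z
        using vE[OF that] by (metis cinner_commute complex_cnj_zero)
      ultimately show "cinner i j = of_bool (i = j)"
        using orthonormal_onD[OF E(1), of i j] vE vv \<open>v \<notin> E\<close> by force
    qed
    ultimately show False
      using E(2) by blast
  qed
  with E(1) show ?thesis
    by (auto simp: is_orthonormal_basis_iff)
qed

text \<open>Some \<open>y\<close> in the span of a finite \<open>F\<close> is close to
  \<open>u\<close>. For finite \<open>F'\<close> between \<open>F\<close> and \<open>E\<close> the
  projection of \<open>u\<close> onto the span of \<open>F'\<close> is at least as close, and the
  partial sum over \<open>F'\<close> is the inner product of \<open>v\<close> with that
  projection.\<close>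

lemma parseval:
  fixes u v :: "'h :: complex_hilbert_space"
  assumes E: "is_orthonormal_basis E"
  shows "((\<lambda>e. cinner v e * cinner e u) has_sum cinner v u) E"
  unfolding has_sum_def
proof (rule tendstoI)
  fix r :: real assume r: "r > 0"
  have on: "orthonormal_on E (\<lambda>e. e)" and cl: "closure (complex_vector.span E) = UNIV"
    using E by (auto simp: is_orthonormal_basis_iff)
  \<comment> \<open>Adding 1 keeps the denominator positive when \<open>v = 0\<close> and still
    gives \<open>norm v * r' < r\<close>.\<close>
  define r' where "r' = r / (norm v + 1)"
  have "norm v + 1 > 0"
    using norm_ge_zero[of v] by linarith
  then have r': "r' > 0" "norm v * r' < r"
    using r by (simp_all add: r'_def pos_divide_less_eq algebra_simps)
  obtain y where y: "y \<in> complex_vector.span E" "norm (u - y) < r'"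
    using cl r'(1) closure_approachable[of u "complex_vector.span E"]
    by (auto simp: dist_norm norm_minus_commute)
  obtain F where F: "finite F" "F \<subseteq> E" "y \<in> complex_vector.span F"
    using y(1) unfolding complex_vector.span_explicit
    by (smt (verit) complex_vector.span_explicit mem_Collect_eq subset_refl)
  have "dist (\<Sum>e\<in>F'. cinner v e * cinner e u) (cinner v u) < r"
    if F': "finite F'" "F \<subseteq> F'" "F' \<subseteq> E" for F'
  proof -
    have on': "orthonormal_on F' (\<lambda>e. e)"
      using on F'(3) by (rule orthonormal_on_subset)
    have "y \<in> complex_vector.span ((\<lambda>e. e) ` F')"
      using F(3) complex_vector.span_mono[OF F'(2)] by auto
    then have le: "norm (u - osum F' (\<lambda>e. e) u) \<le> norm (u - y)"
      by (rule norm_diff_osum_le[OF on' F'(1)])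
    have "(\<Sum>e\<in>F'. cinner v e * cinner e u) = cinner v (osum F' (\<lambda>e. e) u)"
      by (simp add: osum_def cinner_sum_right cinner_scaleC_right mult.commute)
    then have "dist (\<Sum>e\<in>F'. cinner v e * cinner e u) (cinner v u) = cmod (cinner v (u - osum F' (\<lambda>e. e) u))"
      by (simp add: dist_norm cinner_diff_right norm_minus_commute)
    also have "\<dots> \<le> norm v * norm (u - osum F' (\<lambda>e. e) u)"
      by (rule cmod_cinner_le)
    also have "\<dots> \<le> norm v * r'"
      using le y(2) by (intro mult_left_mono) auto
    finally show ?thesis
      using r'(2) by linarith
  qed
  then show "\<forall>\<^sub>F F' in finite_subsets_at_top E. dist (\<Sum>e\<in>F'. cinner v e * cinner e u) (cinner v u) < r"
    unfolding eventually_finite_subsets_at_top using F(1,2) by blast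
qed

text \<open>An orthonormal basis is infinite here: the projection onto the span of a finite one is
  continuous and fixes the dense span, so the span would be the whole space.\<close>

lemma infinite_orthonormal_sequence:
  assumes "infinite_dimensional TYPE('h :: complex_hilbert_space)"
  obtains e :: "nat \<Rightarrow> 'h :: complex_hilbert_space" where "orthonormal_on UNIV e"
proof -
  obtain E :: "'h set" where E: "orthonormal_on E (\<lambda>e. e)" "closure (complex_vector.span E) = UNIV"
    using orthonormal_basis_exists by (auto simp: is_orthonormal_basis_iff)
  have "infinite E"
  proof
    assume fin: "finite E"
    have "x \<in> complex_vector.span E" for x
    proof -
      obtain f where f: "\<And>n. f n \<in> complex_vector.span E" "f \<longlonglongrightarrow> x"
        using E(2) by (metis UNIV_I closure_sequential)
      have "(\<lambda>n. osum E (\<lambda>e. e) (f n)) \<longlonglongrightarrow> osum E (\<lambda>e. e) x"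
        unfolding osum_def
        by (intro tendsto_sum bounded_linear.tendsto[OF bounded_linear_scaleC_left]
            bounded_linear.tendsto[OF bounded_linear_cinner_right] f(2))
      then have "f \<longlonglongrightarrow> osum E (\<lambda>e. e) x"
        using osum_eq[OF E(1) fin] f(1) by simp
      then have "x = osum E (\<lambda>e. e) x"
        using f(2) LIMSEQ_unique by blast
      then show ?thesis
        using osum_in_span[of E "\<lambda>e. e" x] by simp
    qed
    with fin assms show False
      unfolding infinite_dimensional_def by blast
  qed
  then obtain e :: "nat \<Rightarrow> 'h" where "inj e" "range e \<subseteq> E"
    using infinite_countable_subset by blast
  then have "cinner (e i) (e j) = of_bool (i = j)" for i j
    using orthonormal_onD[OF E(1), of "e i" "e j"] by (simp add: inj_eq range_subsetD)
  then have "orthonormal_on UNIV e"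
    by (simp add: orthonormal_on_def)
  then show thesis by (rule that)
qed


section \<open>Operators\<close>

lemma scaleC_blinfun_apply [simp]: "scaleC_blinfun c a x = c *\<^sub>C a x"
  by (simp add: scaleC_blinfun.rep_eq)

lemma norm_scaleC_blinfun: "norm (scaleC_blinfun c a) \<le> cmod c * norm a"
  by (rule norm_blinfun_bound)
     (simp_all add: norm_scaleC norm_blinfun mult.assoc mult_left_mono)

lift_definition ketbra :: "'h :: complex_hilbert_space \<Rightarrow> 'h \<Rightarrow> 'h \<Rightarrow>\<^sub>L 'h"
  is "\<lambda>u v x. cinner v x *\<^sub>C u"
  by (rule bounded_linear_compose[OF bounded_linear_scaleC_left bounded_linear_cinner_right])

lemma ketbra_apply [simp]: "ketbra u v x = cinner v x *\<^sub>C u"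
  by (simp add: ketbra.rep_eq)

lemma blinfun_sum_apply: "blinfun_apply (\<Sum>i\<in>I. a i) x = (\<Sum>i\<in>I. blinfun_apply (a i) x)"
  by (rule blinfun.sum_left)

lemma complex_linearD: "complex_linear a \<Longrightarrow> a (c *\<^sub>C x) = c *\<^sub>C a x"
  by (simp add: complex_linear_def)

lemma complex_linear_add: "complex_linear a \<Longrightarrow> complex_linear b \<Longrightarrow> complex_linear (a + b)"
  by (simp add: complex_linear_def blinfun.add_left scaleC_add_right)

lemma complex_linear_diff: "complex_linear a \<Longrightarrow> complex_linear b \<Longrightarrow> complex_linear (a - b)"
  by (simp add: complex_linear_def blinfun.diff_left complex_vector.scale_right_diff_distrib)

lemma complex_linear_scaleC: "complex_linear a \<Longrightarrow> complex_linear (scaleC_blinfun c a)"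
  by (simp add: complex_linear_def scaleC_scaleC mult.commute)

lemma complex_linear_compose: "complex_linear a \<Longrightarrow> complex_linear b \<Longrightarrow> complex_linear (a o\<^sub>L b)"
  by (simp add: complex_linear_def)

lemma complex_linear_ketbra: "complex_linear (ketbra u v)"
  by (simp add: complex_linear_def cinner_scaleC_right scaleC_scaleC)

lemma complex_linear_zero: "complex_linear 0"
  by (simp add: complex_linear_def)

lemma complex_linear_sum:
  "(\<And>i. i \<in> I \<Longrightarrow> complex_linear (a i)) \<Longrightarrow> complex_linear (\<Sum>i\<in>I. a i)"
  by (induction I rule: infinite_finite_induct) (simp_all add: complex_linear_zero complex_linear_add)

section \<open>Adjoints\<close>

lemma adj_unique:
  assumes "\<And>x y. cinner (blinfun_apply b x) y = cinner x (blinfun_apply a y)"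
  shows "adj a = b"
  unfolding adj_def
proof (rule the_equality)
  fix b' :: "'a \<Rightarrow>\<^sub>L 'a"
  assume "\<forall>x y. cinner (blinfun_apply b' x) y = cinner x (blinfun_apply a y)"
  then show "b' = b"
    by (intro blinfun_eqI cinner_eqI) (simp add: assms)
qed (use assms in blast)

text \<open>This justifies the description in \<open>adj\<close>. Riesz gives the adjoint vector by
  vector, and uniqueness of the representing vector makes it additive and real homogeneous.\<close>

lemma cinner_adj:
  assumes a: "complex_linear a"
  shows "cinner (adj a x) y = cinner x (a y)"
proof -
  have "\<exists>z. \<forall>y. cinner x (a y) = cinner z y" for x
  proof -
    have "bounded_linear (\<lambda>y. cinner x (a y))"
      by (rule bounded_linear_compose[OF bounded_linear_cinner_right blinfun.bounded_linear_right])
    then obtain z where "\<And>y. cinner x (a y) = cinner z y"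
      by (rule riesz_representation) (use a in \<open>simp_all add: complex_linearD cinner_scaleC_right\<close>)
    then show ?thesis by blast
  qed
  then obtain f where f: "\<And>x y. cinner x (a y) = cinner (f x) y"
    by metis
  have "bounded_linear f"
  proof (rule bounded_linear_intro[where K = "norm a"])
    show "f (x + y) = f x + f y" for x y
      by (rule cinner_eqI) (simp add: f[symmetric] cinner_add_left)
    show "f (r *\<^sub>R x) = r *\<^sub>R f x" for r x
      by (rule cinner_eqI) (simp add: f[symmetric] cinner_scaleC_left scaleR_scaleC)
    show "norm (f x) \<le> norm x * norm a" for x
    proof (cases "f x = 0")
      case False
      \<comment> \<open>Pairing \<open>f x\<close> with itself leads to \<open>a (f x)\<close>;
        cancelling one factor \<open>norm (f x)\<close> gives the bound.\<close>
      have "(norm (f x))\<^sup>2 = cmod (cinner x (a (f x)))"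
        by (simp add: f cinner_self norm_power)
      also have "\<dots> \<le> norm x * norm (a (f x))"
        by (rule cmod_cinner_le)
      also have "\<dots> \<le> norm x * (norm a * norm (f x))"
        by (intro mult_left_mono norm_blinfun) simp
      finally show ?thesis
        using False by (simp add: power2_eq_square mult.assoc[symmetric])
    qed simp
  qed
  then have "adj a = Blinfun f"
    by (intro adj_unique) (simp add: bounded_linear_Blinfun_apply f)
  with \<open>bounded_linear f\<close> show ?thesis
    by (simp add: bounded_linear_Blinfun_apply f)
qed

lemma cinner_adj_right:
  assumes "complex_linear a"
  shows "cinner x (adj a y) = cinner (a x) y"
  using cinner_adj[OF assms, of y x] by (metis cinner_commute)

lemma complex_linear_adj: "complex_linear a \<Longrightarrow> complex_linear (adj a)"
  unfolding complex_linear_def[of "adj a"]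
  by (intro allI cinner_eqI) (simp add: cinner_adj cinner_scaleC_left)

lemma adj_add: "complex_linear a \<Longrightarrow> complex_linear b \<Longrightarrow> adj (a + b) = adj a + adj b"
  by (rule adj_unique) (simp add: blinfun.add_left cinner_add_left cinner_add_right cinner_adj)

lemma adj_scaleC: "complex_linear a \<Longrightarrow> adj (scaleC_blinfun c a) = scaleC_blinfun (cnj c) (adj a)"
  by (rule adj_unique) (simp add: cinner_scaleC_left cinner_scaleC_right cinner_adj)

lemma adj_compose: "complex_linear a \<Longrightarrow> complex_linear b \<Longrightarrow> adj (a o\<^sub>L b) = adj b o\<^sub>L adj a"
  by (rule adj_unique) (simp add: cinner_adj)

lemma adj_ketbra: "adj (ketbra u v) = ketbra v u"
  by (rule adj_unique)
     (metis cinner_scaleC_left cinner_scaleC_right cinner_commute complex_cnj_cnj ketbra_apply mult.commute)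

lemma norm_adj_le:
  assumes "complex_linear a"
  shows "norm (adj a) \<le> norm a"
proof (rule norm_blinfun_bound)
  show "norm (adj a x) \<le> norm a * norm x" for x
  proof (cases "adj a x = 0")
    case False
    have "(norm (adj a x))\<^sup>2 = cmod (cinner x (a (adj a x)))"
      by (simp add: cinner_adj[OF assms, symmetric] cinner_self norm_power)
    also have "\<dots> \<le> norm x * norm (a (adj a x))"
      by (rule cmod_cinner_le)
    also have "\<dots> \<le> norm x * (norm a * norm (adj a x))"
      by (intro mult_left_mono norm_blinfun) simp
    finally show ?thesis
      using False by (simp add: power2_eq_square mult.assoc[symmetric] mult.commute)
  qed simp
qed simp

lemma compose_ketbra: "complex_linear a \<Longrightarrow> a o\<^sub>L ketbra u v = ketbra (a u) v"
  by (rule blinfun_eqI) (simp add: complex_linearD)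

lemma ketbra_compose: "complex_linear a \<Longrightarrow> ketbra u v o\<^sub>L a = ketbra u (adj a v)"
  by (rule blinfun_eqI) (simp add: cinner_adj)

lemma blinfun_compose_sum_left: "(\<Sum>i\<in>I. a i) o\<^sub>L c = (\<Sum>i\<in>I. a i o\<^sub>L c)"
  by (rule blinfun_eqI) (simp add: blinfun_sum_apply)

lemma blinfun_compose_sum_right: "c o\<^sub>L (\<Sum>i\<in>I. a i) = (\<Sum>i\<in>I. c o\<^sub>L a i)"
  by (rule blinfun_eqI) (simp add: blinfun_sum_apply blinfun.sum_right)


section \<open>Finite rank operators\<close>

text \<open>For orthonormal families this is the partial isometry that sends \<open>v i\<close> to
  \<open>u i\<close>; with \<open>u = v\<close> it is the projection onto the span of the
  family.\<close>

definition ketbra_sum :: "nat \<Rightarrow> (nat \<Rightarrow> 'h :: complex_hilbert_space) \<Rightarrow> (nat \<Rightarrow> 'h) \<Rightarrow> 'h \<Rightarrow>\<^sub>L 'h" where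
  "ketbra_sum n u v = (\<Sum>i<n. ketbra (u i) (v i))"

lemma ketbra_sum_apply: "ketbra_sum n u v x = (\<Sum>i<n. cinner (v i) x *\<^sub>C u i)"
  by (simp add: ketbra_sum_def blinfun_sum_apply)

lemma ketbra_sum_self_apply: "ketbra_sum n u u x = osum {..<n} u x"
  by (simp add: ketbra_sum_apply osum_def)

lemma complex_linear_ketbra_sum: "complex_linear (ketbra_sum n u v)"
  unfolding ketbra_sum_def by (intro complex_linear_sum complex_linear_ketbra)

lemma adj_ketbra_sum: "adj (ketbra_sum n u v) = ketbra_sum n v u"
proof (rule adj_unique)
  fix x y
  have "cinner (ketbra_sum n v u x) y = (\<Sum>i<n. cinner (ketbra (v i) (u i) x) y)"
    by (simp add: ketbra_sum_apply cinner_sum_left)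
  also have "\<dots> = (\<Sum>i<n. cinner x (ketbra (u i) (v i) y))"
    by (intro sum.cong refl) (metis adj_ketbra cinner_adj complex_linear_ketbra)
  also have "\<dots> = cinner x (ketbra_sum n u v y)"
    by (simp add: ketbra_sum_apply cinner_sum_right)
  finally show "cinner (ketbra_sum n v u x) y = cinner x (ketbra_sum n u v y)" .
qed

lemma norm_ketbra_sum:
  assumes "orthonormal_on {..<n} u" "orthonormal_on {..<n} v"
  shows "norm (ketbra_sum n u v) \<le> 1"
  by (rule norm_blinfun_bound) (simp_all add: ketbra_sum_apply norm_ketbra_sum_le assms)

text \<open>Orthonormality of the middle family removes the cross terms. This computes both products
  of a partial isometry with its adjoint.\<close>

lemma ketbra_sum_compose:
  assumes "orthonormal_on {..<n} v"
  shows "ketbra_sum n u v o\<^sub>L ketbra_sum n v w = ketbra_sum n u w"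
proof (rule blinfun_eqI)
  fix x
  have "(ketbra_sum n u v o\<^sub>L ketbra_sum n v w) x = (\<Sum>i<n. cinner (v i) (ketbra_sum n v w x) *\<^sub>C u i)"
    by (simp only: blinfun_apply_blinfun_compose ketbra_sum_apply[of n u v])
  also have "\<dots> = (\<Sum>i<n. cinner (w i) x *\<^sub>C u i)"
    by (intro sum.cong refl arg_cong2[of _ _ _ _ "(*\<^sub>C)"])
       (simp only: ketbra_sum_apply sum_orthonormal[OF assms finite_lessThan])
  finally show "(ketbra_sum n u v o\<^sub>L ketbra_sum n v w) x = ketbra_sum n u w x"
    by (simp add: ketbra_sum_apply)
qed

lemma finite_rankI:
  "complex_linear a \<Longrightarrow> finite B \<Longrightarrow> (\<And>x. a x \<in> complex_vector.span B) \<Longrightarrow> a \<in> finite_rank_operators"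
  unfolding finite_rank_operators_def by blast

lemma finite_rank_complex_linear: "a \<in> finite_rank_operators \<Longrightarrow> complex_linear a"
  by (simp add: finite_rank_operators_def)

text \<open>The projection onto a finite-dimensional space containing the range fixes
  \<open>a\<close>. This form of finite rank leads to the expansion in
  \<open>finite_rank_eq_sum\<close>.\<close>

lemma finite_rankE:
  assumes "a \<in> finite_rank_operators"
  obtains n u where "orthonormal_on {..<n::nat} u" "ketbra_sum n u u o\<^sub>L a = a"
proof -
  obtain B where B: "finite B" "range (blinfun_apply a) \<subseteq> complex_vector.span B"
    using assms by (auto simp: finite_rank_operators_def)
  obtain n u where u: "orthonormal_on {..<n::nat} u" "B \<subseteq> complex_vector.span (u ` {..<n})"
    using gram_schmidt[OF B(1)] by blast
  have "a x \<in> complex_vector.span (u ` {..<n})" for x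
    using B(2) u(2) complex_vector.span_mono[OF u(2)] by (auto simp: complex_vector.span_span)
  then have "ketbra_sum n u u o\<^sub>L a = a"
    by (intro blinfun_eqI) (simp add: ketbra_sum_self_apply osum_eq[OF u(1)])
  with u(1) show thesis by (rule that)
qed

lemma finite_rank_eq_sum:
  assumes "complex_linear a" "ketbra_sum n u u o\<^sub>L a = a"
  shows "a = (\<Sum>i<n. ketbra (u i) (adj a (u i)))"
proof -
  have "ketbra_sum n u u o\<^sub>L a = (\<Sum>i<n. ketbra (u i) (adj a (u i)))"
    by (simp add: ketbra_sum_def blinfun_compose_sum_left ketbra_compose assms(1))
  then show ?thesis
    by (simp add: assms(2))
qed

lemma finite_rank_ketbra: "ketbra u v \<in> finite_rank_operators"
  by (rule finite_rankI[of _ "{u}"])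
     (simp_all add: complex_linear_ketbra complex_vector.span_scale complex_vector.span_base)

lemma finite_rank_zero: "0 \<in> finite_rank_operators"
  by (rule finite_rankI[of _ "{}"]) (simp_all add: complex_linear_zero)

lemma finite_rank_add:
  assumes "a \<in> finite_rank_operators" "b \<in> finite_rank_operators"
  shows "a + b \<in> finite_rank_operators"
proof -
  obtain A B where AB: "finite A" "range (blinfun_apply a) \<subseteq> complex_vector.span A"
      "finite B" "range (blinfun_apply b) \<subseteq> complex_vector.span B"
    using assms by (auto simp: finite_rank_operators_def)
  have "a x \<in> complex_vector.span (A \<union> B)" "b x \<in> complex_vector.span (A \<union> B)" for x
    using AB(2,4) complex_vector.span_mono[of A "A \<union> B"] complex_vector.span_mono[of B "A \<union> B"]
    by blast+
  then show ?thesis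
    using assms AB(1,3)
    by (intro finite_rankI[of _ "A \<union> B"])
       (simp_all add: finite_rank_complex_linear complex_linear_add blinfun.add_left
          complex_vector.span_add)
qed

lemma finite_rank_scaleC:
  assumes "a \<in> finite_rank_operators"
  shows "scaleC_blinfun c a \<in> finite_rank_operators"
  using assms unfolding finite_rank_operators_def
  by (auto simp: complex_linear_scaleC intro!: complex_vector.span_scale)

lemma finite_rank_sum:
  "(\<And>i. i \<in> I \<Longrightarrow> a i \<in> finite_rank_operators) \<Longrightarrow> (\<Sum>i\<in>I. a i) \<in> finite_rank_operators"
  by (induction I rule: infinite_finite_induct) (simp_all add: finite_rank_zero finite_rank_add)

lemma finite_rank_ketbra_sum: "ketbra_sum n u v \<in> finite_rank_operators"
  unfolding ketbra_sum_def by (intro finite_rank_sum finite_rank_ketbra)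

lemma finite_rank_compose_left:
  assumes "a \<in> finite_rank_operators" "complex_linear b"
  shows "a o\<^sub>L b \<in> finite_rank_operators"
  using assms unfolding finite_rank_operators_def by (auto simp: complex_linear_compose)

lemma finite_rank_compose_right:
  assumes a: "a \<in> finite_rank_operators" and b: "complex_linear b"
  shows "b o\<^sub>L a \<in> finite_rank_operators"
proof -
  obtain n u where "ketbra_sum n u u o\<^sub>L a = a"
    using finite_rankE[OF a] by blast
  then have "b o\<^sub>L a = b o\<^sub>L (\<Sum>i<n. ketbra (u i) (adj a (u i)))"
    using finite_rank_eq_sum finite_rank_complex_linear[OF a] by metis
  also have "\<dots> = (\<Sum>i<n. ketbra (b (u i)) (adj a (u i)))"
    by (simp add: blinfun_compose_sum_right compose_ketbra b)
  finally show ?thesis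
    by (simp add: finite_rank_sum finite_rank_ketbra)
qed

lemma finite_rank_adj:
  assumes a: "a \<in> finite_rank_operators"
  shows "adj a \<in> finite_rank_operators"
proof -
  have cl: "complex_linear a"
    using a by (rule finite_rank_complex_linear)
  obtain n u where "ketbra_sum n u u o\<^sub>L a = a"
    using finite_rankE[OF a] by blast
  then have "adj a = adj a o\<^sub>L ketbra_sum n u u"
    using adj_compose[OF complex_linear_ketbra_sum cl, of n u u] by (simp add: adj_ketbra_sum)
  then show ?thesis
    using finite_rank_compose_right[OF finite_rank_ketbra_sum complex_linear_adj[OF cl]] by metis
qed

text \<open>Whatever \<open>adj x o\<^sub>L x\<close> kills, \<open>x\<close> kills too, so
  \<open>x\<close> vanishes on the complement of a finite-dimensional space. The trace condition in
  \<open>T_lsc\<close> calls for this: it only assumes that this product lies in the ideal.\<close>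

lemma finite_rank_adj_compose_imp:
  assumes x: "complex_linear x" and fr: "adj x o\<^sub>L x \<in> finite_rank_operators"
  shows "x \<in> finite_rank_operators"
proof -
  obtain n u where u: "ketbra_sum n u u o\<^sub>L (adj x o\<^sub>L x) = adj x o\<^sub>L x"
    using finite_rankE[OF fr] by blast
  define w where "w i = adj (adj x o\<^sub>L x) (u i)" for i
  have eq: "adj x o\<^sub>L x = (\<Sum>i<n. ketbra (u i) (w i))"
    unfolding w_def using finite_rank_eq_sum[OF finite_rank_complex_linear[OF fr] u] .
  \<comment> \<open>By \<open>eq\<close>, the product kills every vector orthogonal to all
    \<open>w i\<close>, hence everything orthogonal to the span of \<open>v\<close>.\<close>
  obtain m v where v: "orthonormal_on {..<m::nat} v" "w ` {..<n} \<subseteq> complex_vector.span (v ` {..<m})"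
    using gram_schmidt[of "w ` {..<n}"] by blast
  have "x y = x (ketbra_sum m v v y)" for y
  proof -
    define z where "z = y - ketbra_sum m v v y"
    have "cinner (w i) z = 0" if "i < n" for i
      unfolding z_def ketbra_sum_self_apply using that v by (intro cinner_osum_diff) auto
    then have "(adj x o\<^sub>L x) z = 0"
      by (simp add: eq blinfun_sum_apply)
    then have "cinner (x z) (x z) = 0"
      using cinner_adj_right[OF x, of z "x z"] by simp
    then show ?thesis
      by (simp add: z_def blinfun.diff_right)
  qed
  then have "x = x o\<^sub>L ketbra_sum m v v"
    by (intro blinfun_eqI) simp
  then show ?thesis
    using finite_rank_compose_right[OF finite_rank_ketbra_sum x] by metis
qed

section \<open>Compact operators and their finite rank approximations\<close>

lemma compact_closure_of_subset:
  fixes K :: "'a :: t2_space set"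
  assumes "compact K" "X \<subseteq> K"
  shows "compact (closure X)"
proof -
  have "closure X \<subseteq> K"
    using assms by (intro closure_minimal compact_imp_closed)
  then show ?thesis
    using compact_Int_closed[OF assms(1), of "closure X"] by (simp add: Int_absorb1)
qed

lemma compact_operator_add:
  fixes a b :: "'h :: complex_hilbert_space \<Rightarrow>\<^sub>L 'h"
  assumes "compact (closure (blinfun_apply a ` cball 0 1))" "compact (closure (blinfun_apply b ` cball 0 1))"
  shows "compact (closure (blinfun_apply (a + b) ` cball 0 1))"
proof -
  let ?S = "{x + y |x y. x \<in> closure (blinfun_apply a ` cball 0 1) \<and> y \<in> closure (blinfun_apply b ` cball 0 1)}"
  have "compact ?S"
    using assms by (rule compact_sums)
  moreover have "blinfun_apply (a + b) ` cball 0 1 \<subseteq> ?S"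
  proof
    fix z assume "z \<in> blinfun_apply (a + b) ` cball 0 1"
    then obtain x where x: "x \<in> cball 0 1" "z = a x + b x"
      by (auto simp: blinfun.add_left)
    then have "a x \<in> closure (blinfun_apply a ` cball 0 1)" "b x \<in> closure (blinfun_apply b ` cball 0 1)"
      by (meson closure_subset imageI subsetD)+
    with x show "z \<in> ?S" by blast
  qed
  ultimately show ?thesis
    by (rule compact_closure_of_subset)
qed

lemma compact_operator_ketbra:
  "compact (closure (blinfun_apply (ketbra u v) ` cball 0 1))"
proof -
  have "compact ((\<lambda>c. c *\<^sub>C u) ` cball 0 (norm v))"
    by (intro compact_continuous_image bounded_linear.continuous_on[OF bounded_linear_scaleC_left]
        continuous_on_id compact_cball)
  moreover have "blinfun_apply (ketbra u v) ` cball 0 1 \<subseteq> (\<lambda>c. c *\<^sub>C u) ` cball 0 (norm v)"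
  proof
    fix y assume "y \<in> blinfun_apply (ketbra u v) ` cball 0 1"
    then obtain x where x: "norm x \<le> 1" "y = cinner v x *\<^sub>C u" by auto
    then have "cmod (cinner v x) \<le> norm v"
      using cmod_cinner_le[of v x] mult_left_mono[of "norm x" 1 "norm v"] by simp
    with x show "y \<in> (\<lambda>c. c *\<^sub>C u) ` cball 0 (norm v)" by auto
  qed
  ultimately show ?thesis
    by (rule compact_closure_of_subset)
qed

lemma finite_rank_subset_compact: "finite_rank_operators \<subseteq> elems compact_operators"
proof
  fix a :: "'a \<Rightarrow>\<^sub>L 'a" assume a: "a \<in> finite_rank_operators"
  obtain n u where "ketbra_sum n u u o\<^sub>L a = a"
    using finite_rankE[OF a] by blast
  then have eq: "a = (\<Sum>i<n. ketbra (u i) (adj a (u i)))"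
    using finite_rank_eq_sum finite_rank_complex_linear[OF a] by metis
  have "compact (closure (blinfun_apply (\<Sum>i<k. ketbra (u i) (adj a (u i))) ` cball 0 1))" for k
  proof (induction k)
    case 0
    have "blinfun_apply 0 ` cball (0::'a) 1 \<subseteq> {0 :: 'a}" by auto
    then show ?case
      using compact_closure_of_subset[of "{0 :: 'a}"] by simp
  next
    case (Suc k)
    then show ?case
      unfolding sum.lessThan_Suc using compact_operator_add compact_operator_ketbra by blast
  qed
  then have "compact (closure (blinfun_apply a ` cball 0 1))"
    using eq by metis
  then show "a \<in> elems compact_operators"
    using finite_rank_complex_linear[OF a] by (simp add: compact_operators_def)
qed

lemma norm_le_on_unit_ball:
  fixes a :: "'a :: real_normed_vector \<Rightarrow>\<^sub>L 'b :: real_normed_vector"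
  assumes "0 \<le> r" "\<And>x. norm x \<le> 1 \<Longrightarrow> norm (a x) \<le> r"
  shows "norm a \<le> r"
proof (rule norm_blinfun_bound[OF assms(1)])
  fix x
  show "norm (a x) \<le> r * norm x"
  proof (cases "x = 0")
    case False
    have "norm (a ((1 / norm x) *\<^sub>R x)) \<le> r"
      using False by (intro assms(2)) simp
    then show ?thesis
      using False by (simp add: blinfun.scaleR_right field_simps)
  qed simp
qed

text \<open>Finitely many balls of radius \<open>r\<close> cover the image of the unit ball, and
  \<open>b\<close> is \<open>a\<close> followed by the projection onto the span of their centres.
  The bound on \<open>norm b\<close> keeps families of such approximants bounded.\<close>

lemma compact_operator_approx:
  fixes a :: "'h :: complex_hilbert_space \<Rightarrow>\<^sub>L 'h"
  assumes a: "a \<in> elems compact_operators" and "r > 0"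
  obtains b where "b \<in> finite_rank_operators" "norm (a - b) \<le> r" "norm b \<le> norm a"
proof -
  have cl: "complex_linear a" and "compact (closure (blinfun_apply a ` cball 0 1))"
    using a by (auto simp: compact_operators_def)
  then obtain k where k: "finite k" "closure (blinfun_apply a ` cball 0 1) \<subseteq> (\<Union>x\<in>k. ball x r)"
    using \<open>r > 0\<close>
    by (elim compactE_image[where C = "closure (blinfun_apply a ` cball 0 1)" and f = "\<lambda>x. ball x r"])
       (auto intro: that)
  obtain n u where u: "orthonormal_on {..<n::nat} u" "k \<subseteq> complex_vector.span (u ` {..<n})"
    using gram_schmidt[OF k(1)] by blast
  show thesis
  proof (rule that[of "ketbra_sum n u u o\<^sub>L a"])
    show "ketbra_sum n u u o\<^sub>L a \<in> finite_rank_operators"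
      using finite_rank_ketbra_sum cl by (rule finite_rank_compose_left)
    show "norm (a - (ketbra_sum n u u o\<^sub>L a)) \<le> r"
    proof (rule norm_le_on_unit_ball)
      fix x :: 'h assume "norm x \<le> 1"
      then have "a x \<in> closure (blinfun_apply a ` cball 0 1)"
        by (intro closure_subset[THEN subsetD] imageI) simp
      then obtain y where y: "y \<in> k" "norm (a x - y) < r"
        using k(2) by (auto simp: dist_norm norm_minus_commute)
      then have "norm (a x - osum {..<n} u (a x)) \<le> norm (a x - y)"
        using u by (intro norm_diff_osum_le) auto
      then show "norm ((a - (ketbra_sum n u u o\<^sub>L a)) x) \<le> r"
        using y(2) by (simp add: blinfun.diff_left ketbra_sum_self_apply)
    qed (use \<open>r > 0\<close> in simp)
    have "norm (ketbra_sum n u u o\<^sub>L a) \<le> norm (ketbra_sum n u u) * norm a"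
      by (rule norm_blinfun_compose)
    also have "\<dots> \<le> 1 * norm a"
      by (intro mult_right_mono norm_ketbra_sum u(1)) simp
    finally show "norm (ketbra_sum n u u o\<^sub>L a) \<le> norm a" by simp
  qed
qed

text \<open>The inverse of \<open>p x p\<close> in the corner of \<open>p\<close>, from the fixed point of the contraction
  \<open>w \<mapsto> v + (p - p x p) w\<close>.\<close>

lemma corner_inverse:
  fixes p x :: "'h :: complex_hilbert_space \<Rightarrow>\<^sub>L 'h"
  assumes p: "p \<in> finite_rank_operators" "p o\<^sub>L p = p" "norm p \<le> 1"
    and x: "complex_linear x" "norm (p - x) \<le> 1/2"
  obtains z where "z \<in> finite_rank_operators" "norm z \<le> 2" "p o\<^sub>L x o\<^sub>L p o\<^sub>L z = p"
proof -
  \<comment> \<open>Since \<open>p\<close> is idempotent, \<open>d\<close> is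
    \<open>p - p x p\<close>. Its norm is at most 1/2, which makes the map below a
    contraction.\<close>
  define d where "d = (p o\<^sub>L (p - x)) o\<^sub>L p"
  have cp: "complex_linear p"
    using p(1) by (rule finite_rank_complex_linear)
  have cd: "complex_linear d"
    unfolding d_def by (intro complex_linear_compose complex_linear_diff cp x(1))
  have pp: "p (p y) = p y" for y
    using p(2) by (metis blinfun_apply_blinfun_compose)
  have "norm d \<le> norm (p o\<^sub>L (p - x)) * norm p"
    unfolding d_def by (rule norm_blinfun_compose)
  also have "\<dots> \<le> norm (p o\<^sub>L (p - x)) * 1"
    using p(3) by (rule mult_left_mono) simp
  also have "\<dots> \<le> norm p * norm (p - x)"
    using norm_blinfun_compose by simp
  also have "\<dots> \<le> 1 * (1/2)"
    using p(3) x(2) by (intro mult_mono) auto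
  finally have nd: "norm d \<le> 1/2" by simp
  have dle: "norm (d y) \<le> norm y / 2" for y
    using norm_blinfun[of d y] mult_right_mono[OF nd, of "norm y"] by simp
  have ex1: "\<exists>!w. v + d w = w" for v
  proof (rule banach_fix_type[of "1/2"])
    show "\<forall>y y'. dist (v + d y) (v + d y') \<le> 1/2 * dist y y'"
      using dle by (simp add: dist_norm blinfun.diff_right[symmetric])
  qed auto
  define g where "g v = (THE w. v + d w = w)" for v
  have g: "v + d (g v) = g v" for v
    unfolding g_def using ex1 by (rule theI')
  have g_unique: "w = g v" if "v + d w = w" for v w
    using that g ex1 by blast
  have g_add: "g (v + w) = g v + g w" for v w
    using arg_cong2[OF g[of v] g[of w], of "(+)"]
    by (intro g_unique[symmetric]) (simp add: blinfun.add_right algebra_simps)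
  have g_scale: "g (c *\<^sub>C v) = c *\<^sub>C g v" for c v
    by (rule g_unique[symmetric])
       (use g[of v] in \<open>simp add: complex_linearD[OF cd] scaleC_add_right[symmetric]\<close>)
  have "norm (g v) \<le> norm v * 2" for v
    using g[of v] dle[of "g v"] norm_triangle_ineq[of v "d (g v)"] by simp
  then have bl: "bounded_linear g"
    using g_add g_scale by (intro bounded_linear_intro[where K = 2]) (simp_all add: scaleR_scaleC)
  define z where "z = Blinfun g o\<^sub>L p"
  have z_apply: "z v = g (p v)" for v
    by (simp add: z_def bounded_linear_Blinfun_apply[OF bl])
  have zp: "z v = p v + d (z v)" for v
    using g[of "p v"] by (simp add: z_apply)
  \<comment> \<open>Both summands of \<open>z v = p v + d (z v)\<close> lie in the range of
    \<open>p\<close>, so \<open>z\<close> maps into it. On that range \<open>d\<close> is the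
    identity minus \<open>p x\<close>, which turns the same equation into
    \<open>p x p z = p\<close>.\<close>
  have pz: "p (z v) = z v" for v
  proof -
    have "p (z v) = p (p v) + p (d (z v))"
      by (subst zp) (simp add: blinfun.add_right)
    also have "\<dots> = z v"
      using zp by (simp add: pp d_def)
    finally show ?thesis .
  qed
  show thesis
  proof (rule that[of z])
    have "complex_linear z"
      unfolding complex_linear_def by (simp add: z_apply complex_linearD[OF cp] g_scale)
    moreover have "z = p o\<^sub>L z"
      by (rule blinfun_eqI) (simp add: pz)
    ultimately show "z \<in> finite_rank_operators"
      using finite_rank_compose_left[OF p(1)] by metis
    show "norm z \<le> 2"
    proof (rule norm_blinfun_bound)
      fix v
      have "norm (z v) \<le> norm (p v) * 2"
        unfolding z_apply by fact
      also have "\<dots> \<le> norm v * 2"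
        using norm_blinfun[of p v] mult_right_mono[OF p(3), of "norm v"] by simp
      finally show "norm (z v) \<le> 2 * norm v" by simp
    qed simp
    show "p o\<^sub>L x o\<^sub>L p o\<^sub>L z = p"
    proof (rule blinfun_eqI)
      fix v
      have "d (z v) = z v - p (x (z v))"
        by (simp add: d_def pz blinfun.diff_left blinfun.diff_right)
      then show "(p o\<^sub>L x o\<^sub>L p o\<^sub>L z) v = p v"
        using zp[of v] by (simp add: pz)
    qed
  qed
qed


section \<open>The trace\<close>

lemma has_sum_finite_sum:
  fixes f :: "'i \<Rightarrow> 'a \<Rightarrow> 'b :: topological_comm_monoid_add"
  assumes "finite I" "\<And>i. i \<in> I \<Longrightarrow> (f i has_sum s i) A"
  shows "((\<lambda>x. \<Sum>i\<in>I. f i x) has_sum (\<Sum>i\<in>I. s i)) A"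
  using assms by (induction I rule: finite_induct) (auto intro: has_sum_add)

text \<open>Parseval evaluates each rank-one term, and the result no longer involves
  \<open>E\<close>, so the basis chosen in \<open>Tr\<close> does not matter.\<close>

lemma Tr_has_sum:
  assumes E: "is_orthonormal_basis E" and a: "complex_linear a" "ketbra_sum n u u o\<^sub>L a = a"
  shows "((\<lambda>e. cinner e (a e)) has_sum (\<Sum>i<n. cinner (u i) (a (u i)))) E"
proof -
  define w where "w i = adj a (u i)" for i
  have "a = (\<Sum>i<n. ketbra (u i) (w i))"
    unfolding w_def by (rule finite_rank_eq_sum[OF a])
  then have "cinner e (a e) = cinner e (blinfun_apply (\<Sum>i<n. ketbra (u i) (w i)) e)" for e
    by (rule arg_cong)
  then have "cinner e (a e) = (\<Sum>i<n. cinner (adj a (u i)) e * cinner e (u i))" for e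
    by (simp add: blinfun_sum_apply cinner_sum_right cinner_scaleC_right w_def)
  moreover have "((\<lambda>e. \<Sum>i<n. cinner (adj a (u i)) e * cinner e (u i)) has_sum
      (\<Sum>i<n. cinner (adj a (u i)) (u i))) E"
    by (intro has_sum_finite_sum parseval E) auto
  ultimately show ?thesis
    by (simp add: cinner_adj[OF a(1)])
qed

lemma Tr_eq:
  assumes "complex_linear a" "ketbra_sum n u u o\<^sub>L a = a"
  shows "Tr a = (\<Sum>i<n. cinner (u i) (a (u i)))"
  unfolding Tr_def
  using Tr_has_sum[OF someI_ex[OF orthonormal_basis_exists] assms] by (rule infsumI)

lemma Tr_summable:
  assumes "a \<in> finite_rank_operators"
  shows "(\<lambda>e. cinner e (a e)) summable_on (SOME E. is_orthonormal_basis E)"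
  using finite_rankE[OF assms] Tr_has_sum[OF someI_ex[OF orthonormal_basis_exists]]
    finite_rank_complex_linear[OF assms] has_sum_imp_summable by metis

lemma Tr_add:
  "a \<in> finite_rank_operators \<Longrightarrow> b \<in> finite_rank_operators \<Longrightarrow> Tr (a + b) = Tr a + Tr b"
  unfolding Tr_def by (simp add: blinfun.add_left cinner_add_right infsum_add Tr_summable)

lemma Tr_scaleC: "Tr (scaleC_blinfun c a) = c * Tr a"
  unfolding Tr_def by (simp add: cinner_scaleC_right infsum_cmult_right')

lemma Tr_zero: "Tr 0 = 0"
  unfolding Tr_def by simp

lemma Tr_sum:
  "finite I \<Longrightarrow> (\<And>i. i \<in> I \<Longrightarrow> a i \<in> finite_rank_operators) \<Longrightarrow> Tr (\<Sum>i\<in>I. a i) = (\<Sum>i\<in>I. Tr (a i))"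
  by (induction I rule: finite_induct) (simp_all add: Tr_zero Tr_add finite_rank_sum)

lemma Tr_ketbra: "Tr (ketbra u v) = cinner v u"
  unfolding Tr_def
  using parseval[OF someI_ex[OF orthonormal_basis_exists], of v u]
  by (intro infsumI) (simp add: cinner_scaleC_right)

text \<open>By the rank-one expansion of \<open>a\<close>, both sides are sums of inner products
  that the adjoint of \<open>b\<close> identifies.\<close>

lemma Tr_commute:
  assumes a: "a \<in> finite_rank_operators" and b: "complex_linear b"
  shows "Tr (a o\<^sub>L b) = Tr (b o\<^sub>L a)"
proof -
  obtain n u where "ketbra_sum n u u o\<^sub>L a = a"
    using finite_rankE[OF a] by blast
  then have "a = (\<Sum>i<n. ketbra (u i) (adj a (u i)))"
    by (rule finite_rank_eq_sum[OF finite_rank_complex_linear[OF a]])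
  \<comment> \<open>Calling \<open>adj a (u i)\<close> by the name \<open>w i\<close> removes
    \<open>a\<close> from the right side, so the equation can replace \<open>a\<close>
    everywhere.\<close>
  then obtain w where eq: "a = (\<Sum>i<n. ketbra (u i) (w i))"
    by (rule that)
  have "Tr (a o\<^sub>L b) = (\<Sum>i<n. cinner (adj b (w i)) (u i))"
    by (simp add: eq blinfun_compose_sum_left ketbra_compose b Tr_sum finite_rank_ketbra Tr_ketbra)
  moreover have "Tr (b o\<^sub>L a) = (\<Sum>i<n. cinner (w i) (b (u i)))"
    by (simp add: eq blinfun_compose_sum_right compose_ketbra b Tr_sum finite_rank_ketbra Tr_ketbra)
  ultimately show ?thesis
    by (simp add: cinner_adj[OF b])
qed

text \<open>Evaluated on an orthonormal family whose span contains the range, the trace is the sum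
  of the squares \<open>(norm (y (u i)))\<^sup>2\<close>.\<close>

lemma Tr_nonneg:
  assumes y: "complex_linear y" and fr: "adj y o\<^sub>L y \<in> finite_rank_operators"
  shows "Tr (adj y o\<^sub>L y) \<in> \<real>\<^sub>\<ge>\<^sub>0"
proof -
  obtain n u where "ketbra_sum n u u o\<^sub>L (adj y o\<^sub>L y) = adj y o\<^sub>L y"
    using finite_rankE[OF fr] by blast
  then have "Tr (adj y o\<^sub>L y) = (\<Sum>i<n. cinner (u i) ((adj y o\<^sub>L y) (u i)))"
    using Tr_eq finite_rank_complex_linear[OF fr] by blast
  also have "\<dots> = complex_of_real (\<Sum>i<n. (norm (y (u i)))\<^sup>2)"
    by (simp add: cinner_adj_right[OF y] cinner_self)
  finally show ?thesis
    by (simp only: nonneg_Reals_of_real_iff) (simp add: sum_nonneg)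
qed


section \<open>Bounded families of finite rank operators\<close>

text \<open>This is \<open>linf_finite_rank\<close> without extensionality, so that families can be
  combined pointwise; \<open>linf_finite_rank_iff\<close> is the link.\<close>

definition bdd_fin_rank :: "'g set \<Rightarrow> ('g \<Rightarrow> 'h :: complex_hilbert_space \<Rightarrow>\<^sub>L 'h) set" where
  "bdd_fin_rank S = {a. (\<forall>s\<in>S. a s \<in> finite_rank_operators) \<and> (\<exists>K. \<forall>s\<in>S. norm (a s) \<le> K)}"

lemma bdd_fin_rankI:
  "(\<And>s. s \<in> S \<Longrightarrow> a s \<in> finite_rank_operators) \<Longrightarrow> (\<And>s. s \<in> S \<Longrightarrow> norm (a s) \<le> K) \<Longrightarrow>
   a \<in> bdd_fin_rank S"
  unfolding bdd_fin_rank_def by blast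

lemma bdd_fin_rank_finite_rank: "a \<in> bdd_fin_rank S \<Longrightarrow> s \<in> S \<Longrightarrow> a s \<in> finite_rank_operators"
  by (simp add: bdd_fin_rank_def)

lemma bdd_fin_rank_complex_linear: "a \<in> bdd_fin_rank S \<Longrightarrow> s \<in> S \<Longrightarrow> complex_linear (a s)"
  by (simp add: bdd_fin_rank_def finite_rank_complex_linear)

lemma bdd_fin_rank_bound:
  assumes "a \<in> bdd_fin_rank S"
  obtains K where "K \<ge> 0" "\<And>s. s \<in> S \<Longrightarrow> norm (a s) \<le> K"
proof -
  obtain K where K: "\<And>s. s \<in> S \<Longrightarrow> norm (a s) \<le> K"
    using assms by (auto simp: bdd_fin_rank_def)
  \<comment> \<open>The absolute value is taken because \<open>K\<close> may be negative when
    \<open>S\<close> is empty.\<close>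
  show thesis
    by (rule that[of "\<bar>K\<bar>"]) (use K in \<open>force+\<close>)
qed

lemma bdd_fin_rank_cong:
  assumes "a \<in> bdd_fin_rank S" "\<And>s. s \<in> S \<Longrightarrow> a s = b s"
  shows "b \<in> bdd_fin_rank S"
  using assms unfolding bdd_fin_rank_def by auto

lemma bdd_fin_rank_add:
  assumes "a \<in> bdd_fin_rank S" "b \<in> bdd_fin_rank S"
  shows "(\<lambda>s. a s + b s) \<in> bdd_fin_rank S"
proof -
  obtain K L where "\<And>s. s \<in> S \<Longrightarrow> norm (a s) \<le> K" "\<And>s. s \<in> S \<Longrightarrow> norm (b s) \<le> L"
    using assms bdd_fin_rank_bound by metis
  then show ?thesis
    using assms by (intro bdd_fin_rankI[where K = "K + L"] finite_rank_add)
      (auto simp: bdd_fin_rank_finite_rank norm_triangle_mono)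
qed

lemma bdd_fin_rank_zero: "(\<lambda>s. 0) \<in> bdd_fin_rank S"
  by (rule bdd_fin_rankI[where K = 0]) (simp_all add: finite_rank_zero)

lemma bdd_fin_rank_scaleC:
  assumes "a \<in> bdd_fin_rank S"
  shows "(\<lambda>s. scaleC_blinfun c (a s)) \<in> bdd_fin_rank S"
proof -
  obtain K where "\<And>s. s \<in> S \<Longrightarrow> norm (a s) \<le> K"
    using assms bdd_fin_rank_bound by metis
  then have "norm (scaleC_blinfun c (a s)) \<le> cmod c * K" if "s \<in> S" for s
    using that by (intro norm_scaleC_blinfun[THEN order_trans] mult_left_mono) auto
  then show ?thesis
    using assms by (intro bdd_fin_rankI[where K = "cmod c * K"] finite_rank_scaleC)
      (auto simp: bdd_fin_rank_finite_rank)
qed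

lemma bdd_fin_rank_compose_bounded:
  assumes a: "a \<in> bdd_fin_rank S"
    and b: "\<And>s. s \<in> S \<Longrightarrow> complex_linear (b s)" "\<And>s. s \<in> S \<Longrightarrow> norm (b s) \<le> L"
  shows "(\<lambda>s. a s o\<^sub>L b s) \<in> bdd_fin_rank S" "(\<lambda>s. b s o\<^sub>L a s) \<in> bdd_fin_rank S"
proof -
  obtain K where K: "K \<ge> 0" "\<And>s. s \<in> S \<Longrightarrow> norm (a s) \<le> K"
    using a bdd_fin_rank_bound by metis
  have le: "norm (a s) * norm (b s) \<le> K * L" if "s \<in> S" for s
    using that K b(2) by (intro mult_mono) auto
  show "(\<lambda>s. a s o\<^sub>L b s) \<in> bdd_fin_rank S"
    using a b(1) le norm_blinfun_compose order_trans
    by (intro bdd_fin_rankI[where K = "K * L"] finite_rank_compose_left)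
      (blast intro: bdd_fin_rank_finite_rank)+
  show "(\<lambda>s. b s o\<^sub>L a s) \<in> bdd_fin_rank S"
  proof (rule bdd_fin_rankI[where K = "K * L"])
    show "norm (b s o\<^sub>L a s) \<le> K * L" if "s \<in> S" for s
      using norm_blinfun_compose[of "b s" "a s"] le[OF that] by (simp add: mult.commute)
  qed (use a b(1) in \<open>blast intro: bdd_fin_rank_finite_rank finite_rank_compose_right\<close>)
qed

lemma bdd_fin_rank_compose:
  assumes "a \<in> bdd_fin_rank S" "b \<in> bdd_fin_rank S"
  shows "(\<lambda>s. a s o\<^sub>L b s) \<in> bdd_fin_rank S"
  using bdd_fin_rank_bound[OF assms(2)] bdd_fin_rank_compose_bounded(1)[OF assms(1)]
    bdd_fin_rank_complex_linear[OF assms(2)] by metis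

lemma bdd_fin_rank_adj:
  assumes "a \<in> bdd_fin_rank S"
  shows "(\<lambda>s. adj (a s)) \<in> bdd_fin_rank S"
proof -
  obtain K where K: "\<And>s. s \<in> S \<Longrightarrow> norm (a s) \<le> K"
    using assms bdd_fin_rank_bound by metis
  show ?thesis
  proof (rule bdd_fin_rankI[where K = K])
    show "norm (adj (a s)) \<le> K" if "s \<in> S" for s
      using norm_adj_le[OF bdd_fin_rank_complex_linear[OF assms that]] K[OF that] by simp
  qed (use assms in \<open>blast intro: bdd_fin_rank_finite_rank finite_rank_adj\<close>)
qed

lemma bdd_fin_rank_ketbra_sum:
  assumes "\<And>s. s \<in> S \<Longrightarrow> orthonormal_on {..<n s} (u s)" "\<And>s. s \<in> S \<Longrightarrow> orthonormal_on {..<n s} (v s)"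
  shows "(\<lambda>s. ketbra_sum (n s) (u s) (v s)) \<in> bdd_fin_rank S"
  using assms by (intro bdd_fin_rankI[where K = 1] finite_rank_ketbra_sum norm_ketbra_sum)

lemma bdd_fin_rank_single:
  assumes "a \<in> finite_rank_operators"
  shows "(\<lambda>r. if r = s then a else 0) \<in> bdd_fin_rank S"
  by (rule bdd_fin_rankI[where K = "norm a"]) (auto simp: assms finite_rank_zero)

lemma bdd_fin_rank_zero_on:
  assumes "f \<in> bdd_fin_rank S"
  shows "(\<lambda>s. if s \<in> F then 0 else f s) \<in> bdd_fin_rank S"
proof -
  obtain K where "K \<ge> 0" "\<And>s. s \<in> S \<Longrightarrow> norm (f s) \<le> K"
    using assms bdd_fin_rank_bound by metis
  then show ?thesis
    using assms by (intro bdd_fin_rankI[where K = K])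
      (simp_all add: finite_rank_zero bdd_fin_rank_finite_rank)
qed

lemma linf_finite_rank_iff:
  "f \<in> linf_finite_rank S \<longleftrightarrow> f \<in> extensional S \<and> f \<in> bdd_fin_rank S"
  by (auto simp: linf_finite_rank_def bounded_functions_def compact_operators_def bdd_fin_rank_def
      PiE_iff bdd_above_def)

lemma restrict_in_linf_finite_rank:
  assumes "a \<in> bdd_fin_rank S"
  shows "restrict a S \<in> linf_finite_rank S"
  using bdd_fin_rank_cong[OF assms, of "restrict a S"] by (simp add: linf_finite_rank_iff)


section \<open>The Pedersen ideal\<close>

lemma elems_linf_compact_iff:
  "f \<in> elems (linf S compact_operators) \<longleftrightarrow>
     f \<in> extensional S \<and> (\<forall>s\<in>S. f s \<in> elems compact_operators) \<and> (\<exists>K. \<forall>s\<in>S. norm (f s) \<le> K)"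
  by (auto simp: linf_def bounded_functions_def compact_operators_def PiE_iff bdd_above_def)

lemma elems_linf_compact_complex_linear:
  "f \<in> elems (linf S compact_operators) \<Longrightarrow> s \<in> S \<Longrightarrow> complex_linear (f s)"
  by (simp add: elems_linf_compact_iff) (simp add: compact_operators_def)

lemma linf_finite_rank_subset_elems: "linf_finite_rank S \<subseteq> elems (linf S compact_operators)"
proof
  fix f :: "'a \<Rightarrow> 'b \<Rightarrow>\<^sub>L 'b" assume f: "f \<in> linf_finite_rank S"
  have "f s \<in> elems compact_operators" if "s \<in> S" for s
    using f that
    by (intro subsetD[OF finite_rank_subset_compact]) (auto simp: linf_finite_rank_iff intro: bdd_fin_rank_finite_rank)
  then show "f \<in> elems (linf S compact_operators)"
    using f by (simp add: elems_linf_compact_iff linf_finite_rank_iff bdd_fin_rank_def)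
qed

lemma two_sided_ideal_linf_finite_rank:
  "two_sided_ideal (linf S (compact_operators :: ('h :: complex_hilbert_space \<Rightarrow>\<^sub>L 'h) cstar)) (linf_finite_rank S)"
proof -
  let ?A = "linf S (compact_operators :: ('h \<Rightarrow>\<^sub>L 'h) cstar)"
  have "mult_in ?A a x \<in> linf_finite_rank S \<and> mult_in ?A x a \<in> linf_finite_rank S"
    if a: "a \<in> elems ?A" and x: "x \<in> linf_finite_rank S" for a x
  proof -
    obtain K where "\<And>s. s \<in> S \<Longrightarrow> norm (a s) \<le> K"
      using a by (auto simp: elems_linf_compact_iff)
    then show ?thesis
      using bdd_fin_rank_compose_bounded[of x S a K] elems_linf_compact_complex_linear[OF a] x
      by (simp add: linf_def compact_operators_def linf_finite_rank_iff restrict_in_linf_finite_rank)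
        (metis linf_finite_rank_iff restrict_in_linf_finite_rank)
  qed
  moreover have "(\<lambda>s\<in>S. 0) \<in> linf_finite_rank S"
    by (rule restrict_in_linf_finite_rank[OF bdd_fin_rank_zero])
  moreover have "plus_in ?A x y \<in> linf_finite_rank S"
    if "x \<in> linf_finite_rank S" "y \<in> linf_finite_rank S" for x y
    using that restrict_in_linf_finite_rank[OF bdd_fin_rank_add[of x S y]]
    by (simp add: linf_def compact_operators_def linf_finite_rank_iff)
  moreover have "scale_in ?A c x \<in> linf_finite_rank S" if "x \<in> linf_finite_rank S" for c x
    using that restrict_in_linf_finite_rank[OF bdd_fin_rank_scaleC[of x S c]]
    by (simp add: linf_def compact_operators_def linf_finite_rank_iff)
  ultimately show ?thesis
    unfolding two_sided_ideal_def using linf_finite_rank_subset_elems by blast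
qed

lemma scaleC_blinfun_minus_one: "scaleC_blinfun (-1) a = - a"
  by (rule blinfun_eqI) (simp add: blinfun.minus_left complex_vector.scale_minus_left scaleC_one)

lemma norm_linf_diff:
  "norm_in (linf S compact_operators) (plus_in (linf S compact_operators) a
     (scale_in (linf S compact_operators) (-1) x)) = (SUP s\<in>S. norm (a s - x s))"
  by (simp add: linf_def compact_operators_def scaleC_blinfun_minus_one)

lemma dense_linf_finite_rank:
  assumes "S \<noteq> {}"
  shows "dense_in (linf S (compact_operators :: ('h :: complex_hilbert_space \<Rightarrow>\<^sub>L 'h) cstar)) (linf_finite_rank S)"
  unfolding dense_in_def
proof (intro ballI allI impI)
  fix a and r :: real
  assume a: "a \<in> elems (linf S (compact_operators :: ('h \<Rightarrow>\<^sub>L 'h) cstar))" and r: "r > 0"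
  \<comment> \<open>Half of \<open>r\<close> leaves room for the supremum, which inherits only a
    weak inequality. The third condition makes the chosen family bounded.\<close>
  have "\<exists>b. b \<in> finite_rank_operators \<and> norm (a s - b) \<le> r/2 \<and> norm b \<le> norm (a s)" if "s \<in> S" for s
  proof -
    have "a s \<in> elems compact_operators"
      using a that by (simp add: elems_linf_compact_iff)
    then show ?thesis
      using r by (elim compact_operator_approx[where r = "r/2"]) auto
  qed
  then obtain b where b: "\<And>s. s \<in> S \<Longrightarrow> b s \<in> finite_rank_operators"
    "\<And>s. s \<in> S \<Longrightarrow> norm (a s - b s) \<le> r/2" "\<And>s. s \<in> S \<Longrightarrow> norm (b s) \<le> norm (a s)"
    by metis
  obtain K where "\<And>s. s \<in> S \<Longrightarrow> norm (a s) \<le> K"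
    using a by (auto simp: elems_linf_compact_iff)
  then have "b \<in> bdd_fin_rank S"
    using b(1,3) order_trans by (intro bdd_fin_rankI[where K = K]) blast+
  then have "restrict b S \<in> linf_finite_rank S"
    by (rule restrict_in_linf_finite_rank)
  moreover have "(SUP s\<in>S. norm (a s - restrict b S s)) \<le> r/2"
    using assms b(2) by (intro cSUP_least) auto
  ultimately show "\<exists>x\<in>linf_finite_rank S. norm_in (linf S compact_operators)
      (plus_in (linf S compact_operators) a (scale_in (linf S compact_operators) (-1) x)) < r"
    using r unfolding norm_linf_diff by (intro bexI[of _ "restrict b S"]) auto
qed

lemma linf_finite_rank_subset_dense_ideal:
  fixes I :: "('g \<Rightarrow> 'h :: complex_hilbert_space \<Rightarrow>\<^sub>L 'h) set"
  assumes I: "two_sided_ideal (linf S compact_operators) I" "dense_in (linf S compact_operators) I"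
  shows "linf_finite_rank S \<subseteq> I"
proof
  fix f :: "'g \<Rightarrow> 'h \<Rightarrow>\<^sub>L 'h" assume f: "f \<in> linf_finite_rank S"
  let ?A = "linf S (compact_operators :: ('h \<Rightarrow>\<^sub>L 'h) cstar)"
  have multI: "mult_in ?A a x \<in> I" "mult_in ?A x a \<in> I" if "a \<in> elems ?A" "x \<in> I" for a x
    using I(1) that by (auto simp: two_sided_ideal_def)
  have mult: "mult_in ?A a b = (\<lambda>s\<in>S. a s o\<^sub>L b s)" for a b
    by (simp add: linf_def compact_operators_def)
  have "\<exists>n u. orthonormal_on {..<n::nat} u \<and> ketbra_sum n u u o\<^sub>L f s = f s" if "s \<in> S" for s
    using finite_rankE[of "f s"] f that by (metis linf_finite_rank_iff bdd_fin_rank_finite_rank)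
  then obtain n u where u: "\<And>s. s \<in> S \<Longrightarrow> orthonormal_on {..<n s :: nat} (u s)"
    "\<And>s. s \<in> S \<Longrightarrow> ketbra_sum (n s) (u s) (u s) o\<^sub>L f s = f s"
    by metis
  define p where "p = (\<lambda>s\<in>S. ketbra_sum (n s) (u s) (u s))"
  have "p \<in> linf_finite_rank S"
    unfolding p_def using u(1) by (intro restrict_in_linf_finite_rank bdd_fin_rank_ketbra_sum)
  then have pA: "p \<in> elems ?A"
    using linf_finite_rank_subset_elems by blast
  \<comment> \<open>The constant 1/2 is the one that \<open>corner_inverse\<close> asks for at every
    \<open>s\<close>.\<close>
  obtain x where x: "x \<in> I" "(SUP s\<in>S. norm (p s - x s)) < 1/2"
    using I(2) pA unfolding dense_in_def norm_linf_diff[symmetric] by (meson half_gt_zero zero_less_one)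
  have xA: "x \<in> elems ?A"
    using I(1) x(1) by (auto simp: two_sided_ideal_def)
  obtain K where "\<And>s. s \<in> S \<Longrightarrow> norm (p s) \<le> K"
    using pA by (auto simp: elems_linf_compact_iff)
  moreover obtain L where "\<And>s. s \<in> S \<Longrightarrow> norm (x s) \<le> L"
    using xA by (auto simp: elems_linf_compact_iff)
  ultimately have "norm (p s - x s) \<le> K + L" if "s \<in> S" for s
    using that norm_triangle_ineq4[of "p s" "x s"] by (meson add_mono order_trans)
  \<comment> \<open>A real supremum bounds its members only for sets that are bounded above, so this
    precedes the pointwise estimate.\<close>
  then have "bdd_above ((\<lambda>s. norm (p s - x s)) ` S)"
    by (auto simp: bdd_above_def)
  then have px: "norm (p s - x s) \<le> 1/2" if "s \<in> S" for s
    using cSUP_upper[OF that, of "\<lambda>s. norm (p s - x s)"] x(2) by simp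
  \<comment> \<open>The bound 2 is uniform in \<open>s\<close>, so the pointwise inverses form an
    element of the algebra.\<close>
  have "\<exists>z. z \<in> finite_rank_operators \<and> norm z \<le> 2 \<and> p s o\<^sub>L x s o\<^sub>L p s o\<^sub>L z = p s" if s: "s \<in> S" for s
  proof -
    have ps: "p s \<in> finite_rank_operators" "p s o\<^sub>L p s = p s" "norm (p s) \<le> 1"
      using s u(1) by (simp_all add: p_def finite_rank_ketbra_sum ketbra_sum_compose norm_ketbra_sum)
    show ?thesis
      by (rule corner_inverse[OF ps elems_linf_compact_complex_linear[OF xA s] px[OF s]]) blast
  qed
  then obtain z where z: "\<And>s. s \<in> S \<Longrightarrow> z s \<in> finite_rank_operators" "\<And>s. s \<in> S \<Longrightarrow> norm (z s) \<le> 2"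
    "\<And>s. s \<in> S \<Longrightarrow> p s o\<^sub>L x s o\<^sub>L p s o\<^sub>L z s = p s"
    by metis
  have "restrict z S \<in> linf_finite_rank S"
    using z by (intro restrict_in_linf_finite_rank bdd_fin_rankI)
  then have zA: "restrict z S \<in> elems ?A"
    using linf_finite_rank_subset_elems by blast
  \<comment> \<open>The product \<open>p x p z f\<close> lies in \<open>I\<close> because its factor
    \<open>x\<close> does. On \<open>S\<close> it equals \<open>p f = f\<close>, and outside
    \<open>S\<close> both sides are \<open>undefined\<close>.\<close>
  have "mult_in ?A (mult_in ?A (mult_in ?A (mult_in ?A p x) p) (restrict z S)) f \<in> I"
    using f linf_finite_rank_subset_elems by (intro multI pA zA x(1)) blast
  also have "mult_in ?A (mult_in ?A (mult_in ?A (mult_in ?A p x) p) (restrict z S)) f = f"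
  proof
    fix s
    show "mult_in ?A (mult_in ?A (mult_in ?A (mult_in ?A p x) p) (restrict z S)) f s = f s"
    proof (cases "s \<in> S")
      case True
      then have "p s o\<^sub>L f s = f s"
        using u(2) by (simp add: p_def)
      then show ?thesis
        by (simp add: mult True z(3))
    next
      case False
      then show ?thesis
        using f extensional_arb[of f S s] by (simp add: mult linf_finite_rank_iff)
    qed
  qed
  finally show "f \<in> I" .
qed

text \<open>\<open>linf_finite_rank S\<close> is one of the intersected ideals and lies in all the
  others. Nonemptiness of \<open>S\<close> enters through density, where the norm is a supremum over
  \<open>S\<close>.\<close>

theorem Ped_linf_compact:
  assumes "S \<noteq> {}"
  shows "Ped (linf S compact_operators) = linf_finite_rank S"
  unfolding Ped_def
proof (rule antisym)
  show "\<Inter> {I. two_sided_ideal (linf S compact_operators) I \<and> dense_in (linf S compact_operators) I}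
      \<subseteq> linf_finite_rank S"
    by (intro Inter_lower CollectI conjI two_sided_ideal_linf_finite_rank dense_linf_finite_rank assms)
qed (auto dest: linf_finite_rank_subset_dense_ideal)


section \<open>Additive functions of multiplicities\<close>

text \<open>Here \<open>n\<close> is the rank function of a family of projections. It may be
  unbounded, since projections have norm at most 1 whatever their rank; the growth arguments in
  \<open>finite_weight\<close> and \<open>eq_0\<close> rest on this freedom.\<close>

locale additive_multiplicity =
  fixes S :: "'g set" and \<phi> :: "('g \<Rightarrow> nat) \<Rightarrow> real"
  assumes countable_S: "countable S"
    and add: "\<phi> (\<lambda>s. m s + n s) = \<phi> m + \<phi> n"
    and nonneg: "\<phi> n \<ge> 0"
    and cong: "(\<And>s. s \<in> S \<Longrightarrow> m s = n s) \<Longrightarrow> \<phi> m = \<phi> n"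
begin

definition weight :: "'g \<Rightarrow> real" where "weight s = \<phi> (\<lambda>r. of_bool (r = s))"

lemma zero: "\<phi> (\<lambda>s. 0) = 0"
  using add[of "\<lambda>s. 0" "\<lambda>s. 0"] by simp

lemma mono:
  assumes "\<And>s. s \<in> S \<Longrightarrow> m s \<le> n s"
  shows "\<phi> m \<le> \<phi> n"
proof -
  \<comment> \<open>Truncated subtraction is exact on \<open>S\<close>, and \<open>\<phi>\<close>
    depends only on the values there.\<close>
  have "\<phi> n = \<phi> (\<lambda>s. m s + (n s - m s))"
    using assms by (intro cong) simp
  then show ?thesis
    using add[of m "\<lambda>s. n s - m s"] nonneg[of "\<lambda>s. n s - m s"] by simp
qed

lemma mult: "\<phi> (\<lambda>s. k * n s) = k * \<phi> n"
  by (induction k) (simp_all add: zero add algebra_simps)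

lemma finite_support:
  assumes "finite F"
  shows "\<phi> (\<lambda>s. if s \<in> F then n s else 0) = (\<Sum>s\<in>F. n s * weight s)"
  using assms
proof (induction F)
  case (insert s F)
  have "(\<lambda>r. if r \<in> insert s F then n r else 0) =
      (\<lambda>r. n s * of_bool (r = s) + (if r \<in> F then n r else 0))"
    using insert.hyps by auto
  then have "\<phi> (\<lambda>r. if r \<in> insert s F then n r else 0) =
      \<phi> (\<lambda>r. n s * of_bool (r = s)) + \<phi> (\<lambda>r. if r \<in> F then n r else 0)"
    by (simp only: add)
  then show ?case
    using insert by (simp add: mult weight_def)
qed (simp add: zero)

lemma finite_weight: "finite {s \<in> S. weight s \<noteq> 0}"
proof (rule ccontr)
  assume inf: "infinite {s \<in> S. weight s \<noteq> 0}"
  define n where "n s = nat \<lceil>1 / weight s\<rceil>" for s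
  \<comment> \<open>\<open>F\<close> has more than \<open>\<phi> n\<close> points, and each
    contributes at least 1 to a sum that is at most \<open>\<phi> n\<close>.\<close>
  obtain F where F: "finite F" "card F = Suc (nat \<lceil>\<phi> n\<rceil>)" "F \<subseteq> {s \<in> S. weight s \<noteq> 0}"
    using infinite_arbitrarily_large[OF inf] by blast
  have "1 \<le> n s * weight s" if "s \<in> F" for s
  proof -
    have "weight s > 0"
      using that F(3) nonneg[of "\<lambda>r. of_bool (r = s)"] unfolding weight_def by force
    moreover have "1 / weight s \<le> n s"
      unfolding n_def by (rule real_nat_ceiling_ge)
    ultimately show ?thesis
      by (simp add: pos_divide_le_eq)
  qed
  then have "(\<Sum>s\<in>F. 1) \<le> (\<Sum>s\<in>F. n s * weight s)"
    by (rule sum_mono)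
  also have "\<dots> = \<phi> (\<lambda>s. if s \<in> F then n s else 0)"
    by (rule finite_support[OF F(1), symmetric])
  also have "\<dots> \<le> \<phi> n"
    by (rule mono) simp
  finally show False
    using F(2) real_nat_ceiling_ge[of "\<phi> n"] by simp
qed

lemma eq_0:
  assumes n: "\<And>s. s \<in> S \<Longrightarrow> weight s \<noteq> 0 \<Longrightarrow> n s = 0"
  shows "\<phi> n = 0"
proof (rule ccontr)
  assume "\<phi> n \<noteq> 0"
  then have "\<phi> n > 0"
    using nonneg[of n] by simp
  \<comment> \<open>This enumeration is injective on \<open>S\<close>, so only finitely many points
    have an index below a given \<open>N\<close>.\<close>
  define idx where "idx = to_nat_on S"
  define m where "m s = idx s * n s" for s
  obtain N :: nat where N: "\<phi> m < N * \<phi> n"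
    using ex_less_of_nat_mult[OF \<open>\<phi> n > 0\<close>] by blast
  define F where "F = {s \<in> S. idx s < N}"
  have "inj_on idx F"
    unfolding idx_def F_def using inj_on_to_nat_on[OF countable_S] by (rule inj_on_subset) auto
  moreover have "idx ` F \<subseteq> {..<N}"
    by (auto simp: F_def)
  ultimately have fin: "finite F"
    using finite_subset finite_imageD by blast
  \<comment> \<open>Off \<open>F\<close> the index is at least \<open>N\<close>; on \<open>F\<close>
    the second summand suffices. That summand has value 0 under \<open>\<phi>\<close>, because at
    each point of \<open>S\<close> either \<open>n\<close> or the weight is 0.\<close>
  have "N * n s \<le> m s + (if s \<in> F then N * n s else 0)" if "s \<in> S" for s
    using that by (auto simp: m_def F_def)
  then have "\<phi> (\<lambda>s. N * n s) \<le> \<phi> (\<lambda>s. m s + (if s \<in> F then N * n s else 0))"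
    by (rule mono)
  also have "\<dots> = \<phi> m + (\<Sum>s\<in>F. real (N * n s) * weight s)"
    by (simp only: add finite_support[OF fin, of "\<lambda>s. N * n s"])
  also have "(\<Sum>s\<in>F. real (N * n s) * weight s) = 0"
    using n by (intro sum.neutral) (auto simp: F_def)
  finally show False
    using N by (simp add: mult)
qed

end


section \<open>Traces on bounded families\<close>

lemma ketbra_sum_add:
  "ketbra_sum (m + n) u v = ketbra_sum m u v + ketbra_sum n (\<lambda>i. u (m + i)) (\<lambda>i. v (m + i))"
  by (induction n) (simp_all add: ketbra_sum_def)

lemma adj_zero: "adj 0 = 0"
  by (rule adj_unique) simp

text \<open>\<open>t\<close> stands for a functional in \<open>T_lsc\<close> composed with
  restriction to \<open>S\<close>, so it is defined on all families and \<open>t_cong\<close>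
  expresses that only values on \<open>S\<close> count. The sequence \<open>e\<close> supplies
  projections of every finite rank.\<close>

locale bounded_trace =
  fixes S :: "'g set" and t :: "('g \<Rightarrow> 'h :: complex_hilbert_space \<Rightarrow>\<^sub>L 'h) \<Rightarrow> complex"
    and e :: "nat \<Rightarrow> 'h"
  assumes countable_S: "countable S"
    and e: "orthonormal_on UNIV e"
    and t_add: "a \<in> bdd_fin_rank S \<Longrightarrow> b \<in> bdd_fin_rank S \<Longrightarrow> t (\<lambda>s. a s + b s) = t a + t b"
    and t_scale: "a \<in> bdd_fin_rank S \<Longrightarrow> t (\<lambda>s. scaleC_blinfun c (a s)) = c * t a"
    and t_nonneg: "a \<in> bdd_fin_rank S \<Longrightarrow> t (\<lambda>s. adj (a s) o\<^sub>L a s) \<in> \<real>\<^sub>\<ge>\<^sub>0"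
    and t_trace: "a \<in> bdd_fin_rank S \<Longrightarrow> t (\<lambda>s. adj (a s) o\<^sub>L a s) = t (\<lambda>s. a s o\<^sub>L adj (a s))"
    and t_cong: "(\<And>s. s \<in> S \<Longrightarrow> a s = b s) \<Longrightarrow> t a = t b"
begin

section \<open>Polarisation and the Cauchy-Schwarz inequality\<close>

lemma t_linear4:
  assumes "a \<in> bdd_fin_rank S" "b \<in> bdd_fin_rank S" "c \<in> bdd_fin_rank S" "d \<in> bdd_fin_rank S"
    and "\<And>s. s \<in> S \<Longrightarrow> f s = a s + scaleC_blinfun \<beta> (b s) + scaleC_blinfun \<gamma> (c s) + scaleC_blinfun \<delta> (d s)"
  shows "t f = t a + \<beta> * t b + \<gamma> * t c + \<delta> * t d"
proof -
  have "t f = t (\<lambda>s. a s + scaleC_blinfun \<beta> (b s) + scaleC_blinfun \<gamma> (c s) + scaleC_blinfun \<delta> (d s))"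
    using assms(5) by (rule t_cong)
  then show ?thesis
    by (simp add: t_add t_scale bdd_fin_rank_add bdd_fin_rank_scaleC assms(1-4))
qed

lemma t_expand:
  assumes w: "w \<in> bdd_fin_rank S" and x: "x \<in> bdd_fin_rank S"
  shows "t (\<lambda>s. adj (w s + scaleC_blinfun c (x s)) o\<^sub>L (w s + scaleC_blinfun c (x s))) =
      t (\<lambda>s. adj (w s) o\<^sub>L w s) + c * t (\<lambda>s. adj (w s) o\<^sub>L x s)
      + cnj c * t (\<lambda>s. adj (x s) o\<^sub>L w s) + cnj c * c * t (\<lambda>s. adj (x s) o\<^sub>L x s)" (is ?th1)
    and "t (\<lambda>s. (w s + scaleC_blinfun c (x s)) o\<^sub>L adj (w s + scaleC_blinfun c (x s))) =
      t (\<lambda>s. w s o\<^sub>L adj (w s)) + c * t (\<lambda>s. x s o\<^sub>L adj (w s))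
      + cnj c * t (\<lambda>s. w s o\<^sub>L adj (x s)) + cnj c * c * t (\<lambda>s. x s o\<^sub>L adj (x s))" (is ?th2)
proof -
  have adj: "adj (w s + scaleC_blinfun c (x s)) = adj (w s) + scaleC_blinfun (cnj c) (adj (x s))"
    if "s \<in> S" for s
    using that w x
    by (simp add: bdd_fin_rank_complex_linear adj_add adj_scaleC complex_linear_scaleC)
  have lin: "complex_linear (adj (w s))" "complex_linear (w s)" "complex_linear (x s)" "complex_linear (adj (x s))"
    if "s \<in> S" for s
    using that w x by (simp_all add: bdd_fin_rank_complex_linear complex_linear_adj)
  show ?th1
    by (rule t_linear4)
       (auto intro!: bdd_fin_rank_compose bdd_fin_rank_adj w x blinfun_eqI
         simp: adj blinfun.add_left blinfun.add_right complex_linearD[OF lin(1)] complex_linearD[OF lin(4)]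
           scaleC_add_right scaleC_scaleC)
  show ?th2
    by (rule t_linear4)
       (auto intro!: bdd_fin_rank_compose bdd_fin_rank_adj w x blinfun_eqI
         simp: adj blinfun.add_left blinfun.add_right complex_linearD[OF lin(2)] complex_linearD[OF lin(3)]
           scaleC_add_right scaleC_scaleC mult.commute)
qed

text \<open>Polarisation: the trace identity for \<open>w + c x\<close> with \<open>c = 1\<close>
  and \<open>c = \<i>\<close> separates the two mixed terms.\<close>

lemma t_commute:
  assumes w: "w \<in> bdd_fin_rank S" and x: "x \<in> bdd_fin_rank S"
  shows "t (\<lambda>s. adj (w s) o\<^sub>L x s) = t (\<lambda>s. x s o\<^sub>L adj (w s))"
proof -
  have "c * t (\<lambda>s. adj (w s) o\<^sub>L x s) + cnj c * t (\<lambda>s. adj (x s) o\<^sub>L w s) =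
      c * t (\<lambda>s. x s o\<^sub>L adj (w s)) + cnj c * t (\<lambda>s. w s o\<^sub>L adj (x s))" for c
    using t_trace[OF bdd_fin_rank_add[OF w bdd_fin_rank_scaleC[OF x, of c]]]
    unfolding t_expand[OF w x] t_trace[OF w] t_trace[OF x] by simp
  from this[of 1] this[of \<i>] show ?thesis
    by (simp add: algebra_simps complex_eq_iff)
qed

text \<open>The degenerate case of the Cauchy-Schwarz inequality.\<close>

lemma t_eq_0:
  assumes w: "w \<in> bdd_fin_rank S" and x: "x \<in> bdd_fin_rank S"
    and 0: "t (\<lambda>s. adj (w s) o\<^sub>L w s) = 0"
  shows "t (\<lambda>s. adj (w s) o\<^sub>L x s) = 0"
proof (rule ccontr)
  define A B X where "A = t (\<lambda>s. adj (w s) o\<^sub>L x s)" and "B = t (\<lambda>s. adj (x s) o\<^sub>L w s)"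
    and "X = t (\<lambda>s. adj (x s) o\<^sub>L x s)"
  assume "t (\<lambda>s. adj (w s) o\<^sub>L x s) \<noteq> 0"
  then have A: "A \<noteq> 0" by (simp add: A_def)
  have pos: "c * A + cnj c * B + cnj c * c * X \<in> \<real>\<^sub>\<ge>\<^sub>0" for c
    using t_nonneg[OF bdd_fin_rank_add[OF w bdd_fin_rank_scaleC[OF x, of c]]]
    unfolding t_expand[OF w x] by (simp add: A_def B_def X_def 0)
  have X: "Re X \<ge> 0" "Im X = 0"
    using t_nonneg[OF x] by (auto simp: X_def complex_nonneg_Reals_iff)
  \<comment> \<open>Taking \<open>c = 1\<close> and \<open>c = \<i>\<close> shows that
    \<open>A + B\<close> and \<open>\<i> * (A - B)\<close> are real.\<close>
  have B: "B = cnj A"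
    using pos[of 1] pos[of \<i>] X by (auto simp: complex_nonneg_Reals_iff complex_eq_iff)
  \<comment> \<open>With \<open>c = - (r * cnj A)\<close> the quadratic form becomes
    \<open>(cmod A)\<^sup>2 * r * (r * X - 2)\<close>, which is negative because
    \<open>r * Re X < 1\<close>. The added 1 covers \<open>X = 0\<close>.\<close>
  define r where "r = 1 / (Re X + 1)"
  have r: "r > 0" "r * Re X < 1"
    using X by (auto simp: r_def pos_divide_less_eq)
  have eq: "(- (r * cnj A)) * A + cnj (- (r * cnj A)) * B + cnj (- (r * cnj A)) * (- (r * cnj A)) * X
      = (A * cnj A) * (r * (r * X - 2))"
    by (simp add: B algebra_simps)
  have "Re ((A * cnj A) * (r * (r * X - 2))) \<ge> 0"
    using pos[of "- (r * cnj A)"] unfolding eq by (simp add: complex_nonneg_Reals_iff)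
  also have "Re ((A * cnj A) * (r * (r * X - 2))) = (cmod A)\<^sup>2 * (r * (r * Re X - 2))"
    by (simp add: complex_norm_square[symmetric] flip: of_real_power)
  finally have "r * (r * Re X - 2) \<ge> 0"
    using A by (simp add: zero_le_mult_iff)
  then show False
    using r by (simp add: zero_le_mult_iff)
qed

section \<open>Values on projections as a function of rank\<close>

definition \<phi> :: "('g \<Rightarrow> nat) \<Rightarrow> real" where
  "\<phi> n = Re (t (\<lambda>s. ketbra_sum (n s) e e))"

lemma e_subset: "orthonormal_on I e"
  using e by (rule orthonormal_on_subset) simp

text \<open>The partial isometry from the \<open>u s\<close> family to \<open>e\<close> has the two
  projections as its products with its adjoint, so the trace property equates their values. The
  value therefore depends on the ranks alone.\<close>

lemma t_projection:
  assumes u: "\<And>s. s \<in> S \<Longrightarrow> orthonormal_on {..<n s} (u s)"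
  shows "t (\<lambda>s. ketbra_sum (n s) (u s) (u s)) = complex_of_real (\<phi> n)" and "\<phi> n \<ge> 0"
proof -
  have V: "(\<lambda>s. ketbra_sum (n s) e (u s)) \<in> bdd_fin_rank S"
    by (intro bdd_fin_rank_ketbra_sum u e_subset)
  have 1: "t (\<lambda>s. adj (ketbra_sum (n s) e (u s)) o\<^sub>L ketbra_sum (n s) e (u s)) =
      t (\<lambda>s. ketbra_sum (n s) (u s) (u s))"
    by (intro t_cong) (simp add: adj_ketbra_sum ketbra_sum_compose e_subset)
  moreover have 2: "t (\<lambda>s. ketbra_sum (n s) e (u s) o\<^sub>L adj (ketbra_sum (n s) e (u s))) =
      t (\<lambda>s. ketbra_sum (n s) e e)"
    by (intro t_cong) (simp add: adj_ketbra_sum ketbra_sum_compose u)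
  ultimately have eq: "t (\<lambda>s. ketbra_sum (n s) (u s) (u s)) = t (\<lambda>s. ketbra_sum (n s) e e)"
    using t_trace[OF V] by simp
  have "t (\<lambda>s. ketbra_sum (n s) e e) \<in> \<real>\<^sub>\<ge>\<^sub>0"
    using t_nonneg[OF V] unfolding 1 eq .
  then show "t (\<lambda>s. ketbra_sum (n s) (u s) (u s)) = complex_of_real (\<phi> n)" "\<phi> n \<ge> 0"
    unfolding eq by (auto simp: \<phi>_def complex_nonneg_Reals_iff complex_eq_iff)
qed

sublocale additive_multiplicity S \<phi>
proof
  show "countable S" by (rule countable_S)
  show "\<phi> n \<ge> 0" for n
    by (rule t_projection(2)) (rule e_subset)
  show "\<phi> m = \<phi> n" if "\<And>s. s \<in> S \<Longrightarrow> m s = n s" for m n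
    unfolding \<phi>_def using that by (intro arg_cong[of _ _ Re] t_cong) simp
  fix m n :: "'g \<Rightarrow> nat"
  \<comment> \<open>The projection onto the first \<open>m s + n s\<close> vectors of
    \<open>e\<close> splits into the first \<open>m s\<close> and the next \<open>n s\<close>; the
    latter part has value \<open>\<phi> n\<close> because only its rank matters.\<close>
  have shift: "orthonormal_on {..<n s} (\<lambda>i. e (m s + i))" for s
    using e by (simp add: orthonormal_on_def)
  have "t (\<lambda>s. ketbra_sum (m s + n s) e e) =
      t (\<lambda>s. ketbra_sum (m s) e e) + t (\<lambda>s. ketbra_sum (n s) (\<lambda>i. e (m s + i)) (\<lambda>i. e (m s + i)))"
    unfolding ketbra_sum_add by (intro t_add bdd_fin_rank_ketbra_sum shift e_subset)
  also have "t (\<lambda>s. ketbra_sum (n s) (\<lambda>i. e (m s + i)) (\<lambda>i. e (m s + i))) = \<phi> n"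
    by (rule t_projection(1)) (rule shift)
  finally show "\<phi> (\<lambda>s. m s + n s) = \<phi> m + \<phi> n"
    by (simp add: \<phi>_def)
qed

lemma t_eq_0_off_weights:
  assumes f: "f \<in> bdd_fin_rank S" and 0: "\<And>s. s \<in> S \<Longrightarrow> weight s \<noteq> 0 \<Longrightarrow> f s = 0"
  shows "t f = 0"
proof -
  \<comment> \<open>Rank 0 wherever \<open>f s = 0\<close> makes \<open>n\<close> vanish at all
    points of nonzero weight, as \<open>eq_0\<close> requires.\<close>
  have "\<exists>n u. orthonormal_on {..<n::nat} u \<and> ketbra_sum n u u o\<^sub>L f s = f s \<and> (f s = 0 \<longrightarrow> n = 0)"
    if "s \<in> S" for s
  proof (cases "f s = 0")
    case True
    then show ?thesis
      by (intro exI[of _ 0]) (simp add: orthonormal_on_def)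
  next
    case False
    then show ?thesis
      using finite_rankE bdd_fin_rank_finite_rank[OF f that] by metis
  qed
  then obtain n u where u: "\<And>s. s \<in> S \<Longrightarrow> orthonormal_on {..<n s :: nat} (u s)"
    "\<And>s. s \<in> S \<Longrightarrow> ketbra_sum (n s) (u s) (u s) o\<^sub>L f s = f s" "\<And>s. s \<in> S \<Longrightarrow> f s = 0 \<Longrightarrow> n s = 0"
    by metis
  \<comment> \<open>\<open>adj (w s) o\<^sub>L w s\<close> is the projection that fixes
    \<open>f s\<close>, and its value is \<open>\<phi> n = 0\<close>. Applying \<open>t_eq_0\<close>
    to \<open>w\<close> and the product of \<open>w\<close> and \<open>f\<close> then gives
    \<open>t f = 0\<close>.\<close>
  define w where "w s = ketbra_sum (n s) e (u s)" for s
  have w: "w \<in> bdd_fin_rank S"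
    unfolding w_def by (intro bdd_fin_rank_ketbra_sum u(1) e_subset)
  have ww: "adj (w s) o\<^sub>L w s = ketbra_sum (n s) (u s) (u s)" for s
    by (simp add: w_def adj_ketbra_sum ketbra_sum_compose e_subset)
  have "t (\<lambda>s. adj (w s) o\<^sub>L w s) = \<phi> n"
    unfolding ww using u(1) by (rule t_projection(1))
  also have "\<phi> n = 0"
    using 0 u(3) by (intro eq_0) blast
  finally have "t (\<lambda>s. adj (w s) o\<^sub>L w s) = 0" by simp
  then have "t (\<lambda>s. adj (w s) o\<^sub>L (w s o\<^sub>L f s)) = 0"
    by (rule t_eq_0[OF w bdd_fin_rank_compose[OF w f]])
  moreover have "t (\<lambda>s. adj (w s) o\<^sub>L (w s o\<^sub>L f s)) = t f"
  proof (rule t_cong)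
    fix s assume s: "s \<in> S"
    have "adj (w s) o\<^sub>L (w s o\<^sub>L f s) = (adj (w s) o\<^sub>L w s) o\<^sub>L f s"
      by (rule blinfun_eqI) simp
    then show "adj (w s) o\<^sub>L (w s o\<^sub>L f s) = f s"
      using u(2)[OF s] ww by simp
  qed
  ultimately show ?thesis by simp
qed

text \<open>\<open>ketbra u v\<close> factors through the unit vector \<open>e 0\<close>. In the
  opposite order the factors give \<open>cinner v u\<close> times the projection onto
  \<open>e 0\<close>, and that projection, placed at \<open>s\<close>, has value
  \<open>weight s\<close>.\<close>

lemma t_single_ketbra:
  "t (\<lambda>r. if r = s then ketbra u v else 0) = weight s * cinner v u"
proof -
  define w where "w r = (if r = s then ketbra (e 0) u else 0)" for r
  define x where "x r = (if r = s then ketbra (e 0) v else 0)" for r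
  have ee: "cinner (e 0) (e 0) = 1"
    using orthonormal_onD[OF e] by simp
  have wx: "w \<in> bdd_fin_rank S" "x \<in> bdd_fin_rank S"
    unfolding w_def x_def by (intro bdd_fin_rank_single finite_rank_ketbra)+
  have "t (\<lambda>r. if r = s then ketbra u v else 0) = t (\<lambda>r. adj (w r) o\<^sub>L x r)"
    by (intro t_cong blinfun_eqI)
       (auto simp: w_def x_def adj_ketbra adj_zero cinner_scaleC_right ee)
  also have "\<dots> = t (\<lambda>r. x r o\<^sub>L adj (w r))"
    by (rule t_commute[OF wx])
  also have "\<dots> = t (\<lambda>r. scaleC_blinfun (cinner v u) (ketbra_sum (of_bool (r = s)) e e))"
    by (intro t_cong blinfun_eqI)
       (auto simp: w_def x_def adj_ketbra adj_zero cinner_scaleC_right ketbra_sum_def scaleC_scaleC mult.commute)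
  also have "\<dots> = cinner v u * t (\<lambda>r. ketbra_sum (of_bool (r = s)) e e)"
    by (intro t_scale bdd_fin_rank_ketbra_sum e_subset)
  also have "t (\<lambda>r. ketbra_sum (of_bool (r = s)) e e) = weight s"
    unfolding weight_def by (rule t_projection(1)) (rule e_subset)
  finally show ?thesis
    by (simp add: mult.commute)
qed

lemma t_zero: "t (\<lambda>r. 0) = 0"
  using t_add[of "\<lambda>r. 0" "\<lambda>r. 0"] by (simp add: bdd_fin_rank_zero)

text \<open>Uniqueness of the trace on finite rank operators: the rank-one terms of \<open>a\<close>
  are added up one by one.\<close>

lemma t_single:
  assumes a: "a \<in> finite_rank_operators"
  shows "t (\<lambda>r. if r = s then a else 0) = weight s * Tr a"
proof -
  obtain n u where "ketbra_sum n u u o\<^sub>L a = a"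
    using finite_rankE[OF a] by blast
  then have "a = (\<Sum>i<n. ketbra (u i) (adj a (u i)))"
    by (rule finite_rank_eq_sum[OF finite_rank_complex_linear[OF a]])
  then obtain w where eq: "a = (\<Sum>i<n. ketbra (u i) (w i))"
    by (rule that)
  have "t (\<lambda>r. if r = s then (\<Sum>i<k. ketbra (u i) (w i)) else 0) =
      weight s * (\<Sum>i<k. cinner (w i) (u i))" for k
  proof (induction k)
    case (Suc k)
    have "t (\<lambda>r. if r = s then (\<Sum>i<Suc k. ketbra (u i) (w i)) else 0) =
       t (\<lambda>r. (if r = s then (\<Sum>i<k. ketbra (u i) (w i)) else 0) + (if r = s then ketbra (u k) (w k) else 0))"
      by (rule t_cong) simp
    also have "\<dots> = t (\<lambda>r. if r = s then (\<Sum>i<k. ketbra (u i) (w i)) else 0)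
       + t (\<lambda>r. if r = s then ketbra (u k) (w k) else 0)"
      by (intro t_add bdd_fin_rank_single finite_rank_sum finite_rank_ketbra)
    finally show ?case
      by (simp add: Suc t_single_ketbra algebra_simps)
  next
    case 0
    have "t (\<lambda>r. if r = s then \<Sum>i<0::nat. ketbra (u i) (w i) else 0) = t (\<lambda>r. 0)"
      by (rule t_cong) simp
    then show ?case by (simp add: t_zero)
  qed
  then have "t (\<lambda>r. if r = s then a else 0) = weight s * (\<Sum>i<n. cinner (w i) (u i))"
    unfolding eq .
  also have "(\<Sum>i<n. cinner (w i) (u i)) = Tr a"
    by (simp add: eq Tr_sum finite_rank_ketbra Tr_ketbra)
  finally show ?thesis .
qed

lemma t_split:
  assumes f: "f \<in> bdd_fin_rank S" and F: "finite F" "F \<subseteq> S"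
  shows "t f = t (\<lambda>s. if s \<in> F then 0 else f s) + (\<Sum>s\<in>F. weight s * Tr (f s))"
  using F
proof (induction F)
  case (insert x F)
  have fx: "f x \<in> finite_rank_operators"
    using f insert.prems by (simp add: bdd_fin_rank_finite_rank)
  note BF = bdd_fin_rank_zero_on[OF f, of "insert x F"]
  have "t (\<lambda>s. if s \<in> F then 0 else f s) =
      t (\<lambda>s. (if s \<in> insert x F then 0 else f s) + (if s = x then f x else 0))"
    using insert.hyps by (intro t_cong) auto
  also have "\<dots> = t (\<lambda>s. if s \<in> insert x F then 0 else f s) + weight x * Tr (f x)"
    using t_add[OF BF bdd_fin_rank_single[OF fx]] t_single[OF fx] by simp
  finally show ?case
    using insert by simp
qed simp

theorem t_eq_sum:
  assumes f: "f \<in> bdd_fin_rank S"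
  shows "t f = (\<Sum>s | s \<in> S \<and> weight s \<noteq> 0. weight s * Tr (f s))"
proof -
  let ?F = "{s \<in> S. weight s \<noteq> 0}"
  \<comment> \<open>What remains after removing the finite support of the weights is zero wherever
    the weights are not.\<close>
  have "t (\<lambda>s. if s \<in> ?F then 0 else f s) = 0"
    using bdd_fin_rank_zero_on[OF f] by (rule t_eq_0_off_weights) simp
  then show ?thesis
    using t_split[OF f finite_weight] by simp
qed

end

section \<open>The two inclusions\<close>

lemma T_lsc_subset:
  fixes S :: "'g set" and \<tau> :: "('g \<Rightarrow> 'h :: complex_hilbert_space \<Rightarrow>\<^sub>L 'h) \<Rightarrow> complex"
  assumes S: "S \<noteq> {}" "countable S" and dim: "infinite_dimensional TYPE('h)"
    and \<tau>: "\<tau> \<in> T_lsc (linf S compact_operators)"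
  shows "\<tau> \<in> finite_positive_combinations S"
proof -
  let ?A = "linf S (compact_operators :: ('h \<Rightarrow>\<^sub>L 'h) cstar)"
  note Ped = Ped_linf_compact[OF S(1)]
  note rL = restrict_in_linf_finite_rank
  have ops: "plus_in ?A f g = (\<lambda>s\<in>S. f s + g s)" "scale_in ?A c f = (\<lambda>s\<in>S. scaleC_blinfun c (f s))"
    "mult_in ?A f g = (\<lambda>s\<in>S. f s o\<^sub>L g s)" "star_in ?A f = (\<lambda>s\<in>S. adj (f s))" for f g c
    by (simp_all add: linf_def compact_operators_def)
  obtain e :: "nat \<Rightarrow> 'h" where e: "orthonormal_on UNIV e"
    using infinite_orthonormal_sequence[OF dim] by blast
  have ext: "\<tau> \<in> extensional (linf_finite_rank S)"
    and add: "\<And>x y. x \<in> linf_finite_rank S \<Longrightarrow> y \<in> linf_finite_rank S \<Longrightarrow> \<tau> (plus_in ?A x y) = \<tau> x + \<tau> y"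
    and scale: "\<And>c x. x \<in> linf_finite_rank S \<Longrightarrow> \<tau> (scale_in ?A c x) = c * \<tau> x"
    and nonneg: "\<And>x. x \<in> linf_finite_rank S \<Longrightarrow> positive_in ?A x \<Longrightarrow> \<tau> x \<in> \<real>\<^sub>\<ge>\<^sub>0"
    and trace: "\<And>x. x \<in> elems ?A \<Longrightarrow> mult_in ?A (star_in ?A x) x \<in> linf_finite_rank S \<Longrightarrow>
        \<tau> (mult_in ?A (star_in ?A x) x) = \<tau> (mult_in ?A x (star_in ?A x))"
    using \<tau> unfolding T_lsc_def Ped by auto
  \<comment> \<open>Restriction turns arbitrary families into the extensional ones on which
    \<open>\<tau>\<close> is defined.\<close>
  define t where "t a = \<tau> (restrict a S)" for a
  interpret bounded_trace S t e
  proof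
    show "countable S" "orthonormal_on UNIV e" by fact+
    show "t a = t b" if "\<And>s. s \<in> S \<Longrightarrow> a s = b s" for a b
      unfolding t_def using that by (intro arg_cong[of _ _ \<tau>] restrict_ext)
    show "t (\<lambda>s. a s + b s) = t a + t b" if "a \<in> bdd_fin_rank S" "b \<in> bdd_fin_rank S" for a b
      using add[OF rL rL, OF that] by (simp add: t_def ops cong: restrict_cong)
    show "t (\<lambda>s. scaleC_blinfun c (a s)) = c * t a" if "a \<in> bdd_fin_rank S" for a c
      using scale[OF rL, OF that] by (simp add: t_def ops cong: restrict_cong)
    fix a :: "'g \<Rightarrow> 'h \<Rightarrow>\<^sub>L 'h" assume a: "a \<in> bdd_fin_rank S"
    have el: "restrict a S \<in> elems ?A"
      using rL[OF a] linf_finite_rank_subset_elems by blast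
    have eq: "mult_in ?A (star_in ?A (restrict a S)) (restrict a S) = (\<lambda>s\<in>S. adj (a s) o\<^sub>L a s)"
      "mult_in ?A (restrict a S) (star_in ?A (restrict a S)) = (\<lambda>s\<in>S. a s o\<^sub>L adj (a s))"
      by (auto simp: ops restrict_def)
    have L: "(\<lambda>s\<in>S. adj (a s) o\<^sub>L a s) \<in> linf_finite_rank S"
      using a by (intro rL bdd_fin_rank_compose bdd_fin_rank_adj)
    show "t (\<lambda>s. adj (a s) o\<^sub>L a s) \<in> \<real>\<^sub>\<ge>\<^sub>0"
      unfolding t_def
    proof (rule nonneg[OF L])
      show "positive_in ?A (\<lambda>s\<in>S. adj (a s) o\<^sub>L a s)"
        unfolding positive_in_def by (intro bexI[OF _ el] eq(1)[symmetric])
    qed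
    show "t (\<lambda>s. adj (a s) o\<^sub>L a s) = t (\<lambda>s. a s o\<^sub>L adj (a s))"
      unfolding t_def using trace[OF el] L unfolding eq by simp
  qed
  have "\<tau> = (\<lambda>f\<in>linf_finite_rank S. \<Sum>s | s \<in> S \<and> weight s \<noteq> 0. complex_of_real (weight s) * tau S s f)"
  proof (rule extensionalityI[OF ext])
    fix f :: "'g \<Rightarrow> 'h \<Rightarrow>\<^sub>L 'h" assume f: "f \<in> linf_finite_rank S"
    then have "restrict f S = f" "f \<in> bdd_fin_rank S"
      by (auto simp: linf_finite_rank_iff extensional_restrict)
    then have "\<tau> f = (\<Sum>s | s \<in> S \<and> weight s \<noteq> 0. weight s * Tr (f s))"
      using t_eq_sum[of f] by (simp add: t_def)
    then show "\<tau> f = (\<lambda>f\<in>linf_finite_rank S. \<Sum>s | s \<in> S \<and> weight s \<noteq> 0. complex_of_real (weight s) * tau S s f) f"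
      using f by (simp add: tau_def)
  qed simp
  moreover have "\<forall>s\<in>S. 0 \<le> weight s"
    unfolding weight_def using nonneg by blast
  ultimately show ?thesis
    unfolding finite_positive_combinations_def using finite_weight by blast
qed

lemma sum_nonneg_Reals:
  assumes "\<And>i. i \<in> I \<Longrightarrow> f i \<in> \<real>\<^sub>\<ge>\<^sub>0"
  shows "(\<Sum>i\<in>I. f i) \<in> (\<real>\<^sub>\<ge>\<^sub>0 :: 'a :: real_algebra_1 set)"
  using assms by (induction I rule: infinite_finite_induct) simp_all

lemma finite_positive_combinations_subset:
  fixes S :: "'g set" and \<tau> :: "('g \<Rightarrow> 'h :: complex_hilbert_space \<Rightarrow>\<^sub>L 'h) \<Rightarrow> complex"
  assumes S: "S \<noteq> {}" and \<tau>: "\<tau> \<in> finite_positive_combinations S"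
  shows "\<tau> \<in> T_lsc (linf S compact_operators)"
proof -
  let ?A = "linf S (compact_operators :: ('h \<Rightarrow>\<^sub>L 'h) cstar)"
  let ?L = "linf_finite_rank S :: ('g \<Rightarrow> 'h \<Rightarrow>\<^sub>L 'h) set"
  note Ped = Ped_linf_compact[OF S(1)]
  have ops: "plus_in ?A f g = (\<lambda>s\<in>S. f s + g s)" "scale_in ?A c f = (\<lambda>s\<in>S. scaleC_blinfun c (f s))"
    "mult_in ?A f g = (\<lambda>s\<in>S. f s o\<^sub>L g s)" "star_in ?A f = (\<lambda>s\<in>S. adj (f s))" for f g c
    by (simp_all add: linf_def compact_operators_def)
  obtain c where c: "\<And>s. s \<in> S \<Longrightarrow> 0 \<le> c s"
    and "\<tau> = (\<lambda>f\<in>?L. \<Sum>s | s \<in> S \<and> c s \<noteq> 0. complex_of_real (c s) * tau S s f)"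
    using \<tau> by (auto simp: finite_positive_combinations_def)
  then have \<tau>: "\<tau> \<in> extensional ?L"
    "\<And>f. f \<in> ?L \<Longrightarrow> \<tau> f = (\<Sum>s | s \<in> S \<and> c s \<noteq> 0. complex_of_real (c s) * Tr (f s))"
    by (auto simp: tau_def)
  have ideal: "plus_in ?A x y \<in> ?L" "scale_in ?A d x \<in> ?L" if "x \<in> ?L" "y \<in> ?L" for x y d
    using two_sided_ideal_linf_finite_rank[of S] that by (auto simp: two_sided_ideal_def)
  have fr: "f s \<in> finite_rank_operators" if "f \<in> ?L" "s \<in> S" for f s
    using that by (auto simp: linf_finite_rank_iff bdd_fin_rank_finite_rank)
  have "\<tau> (plus_in ?A x y) = \<tau> x + \<tau> y" if "x \<in> ?L" "y \<in> ?L" for x y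
    using that
    by (simp add: \<tau>(2) ideal, simp add: ops Tr_add fr sum.distrib distrib_left)
  moreover have "\<tau> (scale_in ?A d x) = d * \<tau> x" if "x \<in> ?L" for x d
    using that by (simp add: \<tau>(2) ideal, simp add: ops Tr_scaleC sum_distrib_left mult.left_commute)
  moreover have "\<tau> x \<in> \<real>\<^sub>\<ge>\<^sub>0" if x: "x \<in> ?L" "positive_in ?A x" for x
  proof -
    obtain y where y: "y \<in> elems ?A" "x = mult_in ?A (star_in ?A y) y"
      using x(2) by (auto simp: positive_in_def)
    have "complex_of_real (c s) * Tr (x s) \<in> \<real>\<^sub>\<ge>\<^sub>0" if s: "s \<in> S" for s
    proof -
      have "x s = adj (y s) o\<^sub>L y s"
        using s by (simp add: y(2) ops)
      then show ?thesis
        using Tr_nonneg[OF elems_linf_compact_complex_linear[OF y(1) s]] fr[OF x(1) s] c[OF s]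
        by (intro nonneg_Reals_mult_I) simp_all
    qed
    then show ?thesis
      unfolding \<tau>(2)[OF x(1)] by (intro sum_nonneg_Reals) simp
  qed
  moreover have "\<tau> (mult_in ?A (star_in ?A x) x) = \<tau> (mult_in ?A x (star_in ?A x))"
    if x: "x \<in> elems ?A" "mult_in ?A (star_in ?A x) x \<in> ?L" for x
  proof -
    \<comment> \<open>Here \<open>x\<close> is only known to have compact values. Finite rank of the
      product at \<open>s\<close> passes to \<open>x s\<close>, so the product in the other order
      lies in the ideal as well and \<open>Tr_commute\<close> applies.\<close>
    have frx: "x s \<in> finite_rank_operators" if s: "s \<in> S" for s
      using finite_rank_adj_compose_imp[OF elems_linf_compact_complex_linear[OF x(1) s]] fr[OF x(2) s] s
      by (simp add: ops)
    then have xB: "x \<in> bdd_fin_rank S"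
      using x(1) by (auto simp: bdd_fin_rank_def elems_linf_compact_iff)
    have eq: "mult_in ?A x (star_in ?A x) = (\<lambda>s\<in>S. x s o\<^sub>L adj (x s))"
      by (auto simp: ops)
    have L: "mult_in ?A x (star_in ?A x) \<in> ?L"
      unfolding eq using xB by (intro restrict_in_linf_finite_rank bdd_fin_rank_compose bdd_fin_rank_adj)
    show ?thesis
      unfolding \<tau>(2)[OF x(2)] \<tau>(2)[OF L]
      using Tr_commute[OF frx complex_linear_adj[OF finite_rank_complex_linear[OF frx]]]
      by (intro sum.cong refl) (simp add: ops)
  qed
  ultimately show ?thesis
    using \<tau>(1) by (simp add: T_lsc_def Ped)
qed

theorem proposition5p2:
  fixes G :: "('g, 'm) monoid_scheme"
  assumes "group G" and "countable (carrier G)"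
    and "separable_space (euclidean :: 'h :: complex_hilbert_space topology)"
    and "infinite_dimensional TYPE('h)"
  shows "T_lsc (linf (carrier G) (compact_operators :: ('h \<Rightarrow>\<^sub>L 'h) cstar)) =
         finite_positive_combinations (carrier G)"
proof -
  have "carrier G \<noteq> {}"
    using assms(1) group.is_monoid monoid.one_closed by blast
  then show ?thesis
    using T_lsc_subset[OF _ assms(2,4)] finite_positive_combinations_subset[of "carrier G"]
    by (intro equalityI subsetI)
qed

end
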